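(* Let $\nu\in\mathcal P_2(\mathbb R^d)$ and $\mathcal D\subset\mathcal P_2(\mathbb R^d)$, and consider $$(\mathrm{V})\qquad\max\{\operatorname{Var}(\mu):\mu\in\mathcal D,\ \mu\preceq_c\nu\}.$$ (i) If $\mathcal D$ is closed in the $\mathcal W_2$ metric and $\mathcal D\cap\mathcal M_\nu\neq\emptyset$, then $(\mathrm V)$ admits a maximizer. (ii) If $\mu^*$ is a maximizer of $(\mathrm V)$, then for every $\rho\in\mathcal D$ with $\rho\preceq_c\nu$, $$\mathcal W_2(\mu^*,\rho)\le\sqrt{\operatorname{Var}(\nu)-\operatorname{Var}(\rho)}+\mathcal W_2(\nu,\rho).$$
   Context: $\mathcal P_2(\mathbb R^d)$: Borel probability measures on $\mathbb R^d$ with finite second moment; $\mathcal W_2$ the quadratic Wasserstein distance. $\operatorname{Var}(\mu)=\int|x-\int z\,d\mu(z)|^2d\mu(x)$. Convex order: $\mu\preceq_c\nu$ iff $\int f\,d\mu\le\int f\,d\nu$ for every convex $f$. $\mathcal M_\nu=\{\mu\in\mathcal P_2(\mathbb R^d):\mu\preceq_c\nu\}$. *)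

theory Defs
  imports "HOL-Probability.Probability"
begin

definition P2 :: "'a::euclidean_space measure set" where
  "P2 = {\<mu>. sets \<mu> = sets borel \<and> prob_space \<mu> \<and> integrable \<mu> (\<lambda>x. norm x ^ 2)}"

definition couplings :: "'a::euclidean_space measure \<Rightarrow> 'a measure \<Rightarrow> ('a \<times> 'a) measure set" where
  "couplings \<mu> \<nu> = {\<pi>. prob_space \<pi> \<and> sets \<pi> = sets (borel \<Otimes>\<^sub>M borel) \<and>
      distr \<pi> borel fst = \<mu> \<and> distr \<pi> borel snd = \<nu>}"

definition W2 :: "'a::euclidean_space measure \<Rightarrow> 'a measure \<Rightarrow> real" where
  "W2 \<mu> \<nu> = sqrt (INF \<pi>\<in>couplings \<mu> \<nu>. \<integral>z. (norm (fst z - snd z))^2 \<partial>\<pi>)"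

definition Var :: "'a::euclidean_space measure \<Rightarrow> real" where
  "Var \<mu> = (\<integral>x. (norm (x - (\<integral>z. z \<partial>\<mu>)))^2 \<partial>\<mu>)"

text \<open>Convex order.  For \<mu>,\<nu> in P2 and convex f, the integral of f is well defined in
  (-\<infinity>,+\<infinity>] (f has an affine minorant).  The inequality
  \<open>\<integral> f d\<mu> \<le> \<integral> f d\<nu>\<close> is trivial when f is not \<nu>-integrable, and otherwise requires
  f to be \<mu>-integrable with the inequality of finite integrals.\<close>
definition convex_order :: "'a::euclidean_space measure \<Rightarrow> 'a measure \<Rightarrow> bool" where
  "convex_order \<mu> \<nu> \<longleftrightarrow> (\<forall>f::'a \<Rightarrow> real. convex_on UNIV f \<longrightarrow> integrable \<nu> f \<longrightarrow>
      integrable \<mu> f \<and> (\<integral>x. f x \<partial>\<mu>) \<le> (\<integral>x. f x \<partial>\<nu>))"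

definition M_nu :: "'a::euclidean_space measure \<Rightarrow> 'a measure set" where
  "M_nu \<nu> = {\<mu>\<in>P2. convex_order \<mu> \<nu>}"

definition W2_closed :: "'a::euclidean_space measure set \<Rightarrow> bool" where
  "W2_closed D \<longleftrightarrow> (\<forall>\<mu>s \<mu>. (\<forall>n. \<mu>s n \<in> D) \<longrightarrow> \<mu> \<in> P2 \<longrightarrow>
      (\<lambda>n. W2 (\<mu>s n) \<mu>) \<longlonglongrightarrow> 0 \<longrightarrow> \<mu> \<in> D)"

definition is_V_maximizer :: "'a::euclidean_space measure set \<Rightarrow> 'a measure \<Rightarrow> 'a measure \<Rightarrow> bool" where
  "is_V_maximizer D \<nu> \<mu> \<longleftrightarrow> \<mu> \<in> D \<inter> M_nu \<nu> \<and> (\<forall>\<rho>\<in>D \<inter> M_nu \<nu>. Var \<rho> \<le> Var \<mu>)"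

end

(* Existence: convex order dominates the tails, because (max 0 (|x| - R))^2 is convex, so second
   moments are uniformly integrable on the admissible set.  R^d is embedded in the real line by a
   Borel map with uniformly continuous inverse; this carries the one-dimensional theorems of Helly
   and Skorohod over to R^d, and a maximizing sequence then has a subsequence of random variables
   converging in L2.  Convex order passes to the limit by Fatou.

   Stability: by the triangle inequality it suffices that W2(mu, nu)^2 <= Var nu - Var mu for mu
   below nu in convex order.  Instead of a martingale coupling (Strassen), an almost optimal coupling
   is built from entropically regularized semi-discrete duality: discretize mu to finitely many
   values v of masses p_v, and minimize
     sum_v p_v phi_v + eps * int ln (sum_v exp ((v.y - phi_v) / eps)) dnu(y)  over phi.
   The first-order condition says that the softmax weights have nu-integrals p_v, so they define a
   coupling.  Its correlation is at least the dual value up to O(eps), and since max_v (v.y - phi_v)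
   is convex in y, this dual value is bounded below by replacing nu with mu.

   Couplings are glued without disintegration: the middle marginals are only matched up to the
   level sets of a simple function, which costs an arbitrarily small L2 error. *)

theory Submission
  imports Defs
begin


text \<open>For d > 1 there is no continuous injection of R^d into the line, so the code is only
  Borel. What must be continuous is the decoding, and uniformly so: a limit of codes lies in the
  closure of the range, possibly outside the range itself, and a uniformly continuous inverse
  extends to that closure. The bound on \<open>W2\<close> rests on polarization. Convex order forces
  equal means, so \<open>Var \<nu> - Var \<mu>\<close> is the difference of the second moments, and
  the bound asks for couplings whose correlation E(x . y) is at least E |x|^2 up to a small error.
  Without regularization the dual sends y to a maximizer of v . y - phi_v, and ties would have to be
  split by hand to reach the masses p_v. Softmax weights split them by a formula, and optimality
  becomes an equation. Discretizing \<open>\<mu>\<close> leaves finitely many dual variables, so a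
  minimizer exists by compactness.\<close>

section \<open>A Borel code of a Euclidean space in the real line\<close>

text \<open>Digits at most \<open>3\<close> in base \<open>8\<close> leave gaps, so that nearby values share their leading digits. The
  zeroth digit is an arbitrary integer.\<close>

definition octal_value :: "(nat \<Rightarrow> int) \<Rightarrow> real" where
  "octal_value w = (\<Sum>k. of_int (w k) / 8 ^ k)"

lemma octal_summable:
  assumes "\<And>k. 1 \<le> k \<Longrightarrow> w k \<in> {0..3}"
  shows "summable (\<lambda>k. of_int (w k) / (8::real) ^ k)"
proof (rule summable_comparison_test_ev)
  show "summable (\<lambda>k. 3 * (1/8::real) ^ k)"
    by (intro summable_mult summable_geometric) auto
  have "norm (of_int (w k) / (8::real) ^ k) \<le> 3 * (1/8) ^ k" if "1 \<le> k" for k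
    using assms[OF that] by (auto simp: power_divide divide_simps)
  then show "\<forall>\<^sub>F k in sequentially. norm (of_int (w k) / (8::real) ^ k) \<le> 3 * (1/8) ^ k"
    using eventually_sequentially by blast
qed

lemma octal_value_shift:
  assumes "\<And>k. 1 \<le> k \<Longrightarrow> w k \<in> {0..3}"
  shows "octal_value w = of_int (w 0) + octal_value (\<lambda>k. w (Suc k)) / 8"
proof -
  have s: "summable (\<lambda>k. of_int (w (Suc k)) / (8::real) ^ k)"
    using octal_summable[of "\<lambda>k. w (Suc k)"] assms by auto
  have "octal_value w = of_int (w 0) + (\<Sum>k. of_int (w (Suc k)) / (8::real) ^ Suc k)"
    using suminf_split_head[of "\<lambda>k. of_int (w k) / (8::real) ^ k", OF octal_summable[of w, OF assms]]
    by (simp add: octal_value_def)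
  also have "(\<Sum>k. of_int (w (Suc k)) / (8::real) ^ Suc k) = octal_value (\<lambda>k. w (Suc k)) / 8"
    unfolding octal_value_def suminf_divide[OF s, symmetric]
    by (simp add: field_simps)
  finally show ?thesis .
qed

lemma octal_value_bounds:
  assumes "\<And>k. w k \<in> {0..3}"
  shows "0 \<le> octal_value w" "octal_value w \<le> 24/7"
proof -
  have s: "summable (\<lambda>k. of_int (w k) / (8::real) ^ k)"
    using octal_summable assms by auto
  show "0 \<le> octal_value w"
    unfolding octal_value_def using assms by (intro suminf_nonneg s) auto
  have "octal_value w \<le> (\<Sum>k. 3 * (1/8::real) ^ k)"
    unfolding octal_value_def
  proof (rule suminf_le[OF _ s])
    show "summable (\<lambda>k. 3 * (1/8::real) ^ k)"
      by (intro summable_mult summable_geometric) auto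
    show "of_int (w k) / (8::real) ^ k \<le> 3 * (1/8) ^ k" for k
      using assms[of k] by (auto simp: power_divide divide_simps)
  qed
  also have "\<dots> = 24/7"
    by (subst suminf_mult) (auto simp: suminf_geometric)
  finally show "octal_value w \<le> 24/7" .
qed

text \<open>Each tail contributes between 0 and (24/7)/8 = 3/7. As 1/2 + 3/7 < 1, the two integer
  heads differ by less than 1.\<close>

lemma octal_head_eq:
  assumes "\<And>k. 1 \<le> k \<Longrightarrow> w k \<in> {0..3}" "\<And>k. 1 \<le> k \<Longrightarrow> w' k \<in> {0..3}"
    and "\<bar>octal_value w - octal_value w'\<bar> < 1 / 2"
  shows "w 0 = w' 0"
proof -
  have "0 \<le> octal_value (\<lambda>k. w (Suc k))" "octal_value (\<lambda>k. w (Suc k)) \<le> 24/7"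
    "0 \<le> octal_value (\<lambda>k. w' (Suc k))" "octal_value (\<lambda>k. w' (Suc k)) \<le> 24/7"
    using octal_value_bounds[of "\<lambda>k. w (Suc k)"] octal_value_bounds[of "\<lambda>k. w' (Suc k)"] assms(1,2)
    by (simp_all del: atLeastAtMost_iff)
  then have "\<bar>real_of_int (w 0) - of_int (w' 0)\<bar> < 1"
    using assms(3) octal_value_shift[of w, OF assms(1)] octal_value_shift[of w', OF assms(2)]
    by linarith
  then show ?thesis by linarith
qed

text \<open>Equal heads cancel, and dropping them multiplies the difference by 8, which turns the
  threshold for \<open>Suc K\<close> into the one for \<open>K\<close>. The sequences therefore vary
  in the induction.\<close>

lemma octal_digits_eq:
  assumes "\<And>k. 1 \<le> k \<Longrightarrow> w k \<in> {0..3}" "\<And>k. 1 \<le> k \<Longrightarrow> w' k \<in> {0..3}"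
    and "\<bar>octal_value w - octal_value w'\<bar> < 1 / (2 * 8 ^ K)" and "k \<le> K"
  shows "w k = w' k"
  using assms
proof (induction K arbitrary: w w' k)
  case (0 w w' k)
  then show ?case using octal_head_eq[of w w'] by (simp del: atLeastAtMost_iff)
next
  case (Suc K w w' k)
  have "(1::real) \<le> 8 ^ Suc K" by (rule one_le_power) simp
  then have "1 / (2 * 8 ^ Suc K) \<le> (1/2::real)" by (simp add: field_simps)
  then have "\<bar>octal_value w - octal_value w'\<bar> < 1/2" using Suc.prems(3) by linarith
  then have w0: "w 0 = w' 0" using octal_head_eq[of w w'] Suc.prems(1,2) by blast
  show ?case
  proof (cases k)
    case k: (Suc j)
    have "\<bar>octal_value w - octal_value w'\<bar> = \<bar>octal_value (\<lambda>k. w (Suc k)) - octal_value (\<lambda>k. w' (Suc k))\<bar> / 8"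
    proof -
      have "octal_value w = of_int (w 0) + octal_value (\<lambda>k. w (Suc k)) / 8"
        by (rule octal_value_shift) (rule Suc.prems(1))
      moreover have "octal_value w' = of_int (w' 0) + octal_value (\<lambda>k. w' (Suc k)) / 8"
        by (rule octal_value_shift) (rule Suc.prems(2))
      ultimately show ?thesis using w0 by (simp flip: diff_divide_distrib)
    qed
    then have d: "\<bar>octal_value (\<lambda>k. w (Suc k)) - octal_value (\<lambda>k. w' (Suc k))\<bar> < 1 / (2 * 8 ^ K)"
    proof -
      have "1 / (2 * 8 ^ Suc K) = (1 / (2 * 8 ^ K)) / (8::real)" by simp
      then have "\<bar>octal_value (\<lambda>k. w (Suc k)) - octal_value (\<lambda>k. w' (Suc k))\<bar> / 8 < (1 / (2 * 8 ^ K)) / 8"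
        using Suc.prems(3) \<open>\<bar>octal_value w - octal_value w'\<bar> = _ / 8\<close> by (simp only:)
      then show ?thesis by (subst (asm) divide_less_cancel) simp
    qed
    have "w (Suc j) = w' (Suc j)"
      by (rule Suc.IH[of "\<lambda>k. w (Suc k)" "\<lambda>k. w' (Suc k)" j, OF _ _ d])
        (use Suc.prems(4) k in \<open>auto intro!: Suc.prems(1,2) simp del: atLeastAtMost_iff\<close>)
    then show ?thesis using k by simp
  qed (simp add: w0)
qed

section \<open>Coding two reals by one through their binary expansions\<close>

definition binary_digit :: "nat \<Rightarrow> real \<Rightarrow> int" where
  "binary_digit k t = \<lfloor>2 ^ Suc k * t\<rfloor> - 2 * \<lfloor>2 ^ k * t\<rfloor>"

lemma binary_digit_range: "binary_digit k t \<in> {0, 1}"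
proof -
  have "2 ^ Suc k * t = 2 * (2 ^ k * t)" by simp
  then have "0 \<le> binary_digit k t" "binary_digit k t \<le> 1" unfolding binary_digit_def by linarith+
  then show ?thesis by auto
qed

text \<open>Digit 0 is the first one after the binary point, so the integer part and the digits
  below \<open>K\<close> rebuild the floor at scale 2^K, doubling once per digit.\<close>

lemma floor_eq_of_binary_digits:
  assumes "\<lfloor>s\<rfloor> = \<lfloor>t\<rfloor>" and "\<And>k. k < K \<Longrightarrow> binary_digit k s = binary_digit k t"
  shows "\<lfloor>2 ^ K * s\<rfloor> = \<lfloor>2 ^ K * t\<rfloor>"
  using assms(2)
proof (induction K)
  case (Suc K)
  then have "\<lfloor>2 ^ K * s\<rfloor> = \<lfloor>2 ^ K * t\<rfloor>" "binary_digit K s = binary_digit K t" by auto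
  then show ?case by (simp add: binary_digit_def)
qed (use assms(1) in simp)

lemma abs_diff_less_of_binary_digits:
  fixes s t :: real
  assumes "\<lfloor>s\<rfloor> = \<lfloor>t\<rfloor>" and "\<And>k. k < K \<Longrightarrow> binary_digit k s = binary_digit k t"
  shows "\<bar>s - t\<bar> < 1 / 2 ^ K"
proof -
  have "\<lfloor>2 ^ K * s\<rfloor> = \<lfloor>2 ^ K * t\<rfloor>"
    by (rule floor_eq_of_binary_digits) fact+
  then have "\<bar>2 ^ K * s - 2 ^ K * t\<bar> < 1" by linarith
  then have "2 ^ K * \<bar>s - t\<bar> < 1"
    by (simp add: abs_mult flip: right_diff_distrib)
  then show ?thesis by (simp add: field_simps)
qed

text \<open>The head encodes both integer parts injectively. Each later digit packs one binary digit
  of \<open>s\<close> and one of \<open>t\<close> into a value of at most 3, as the gaps in base 8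
  require.\<close>

definition pair_digits :: "real \<Rightarrow> real \<Rightarrow> nat \<Rightarrow> int" where
  "pair_digits s t k = (case k of 0 \<Rightarrow> int (prod_encode (int_encode \<lfloor>s\<rfloor>, int_encode \<lfloor>t\<rfloor>))
     | Suc j \<Rightarrow> binary_digit j s + 2 * binary_digit j t)"

definition pair_code :: "real \<Rightarrow> real \<Rightarrow> real" where
  "pair_code s t = octal_value (pair_digits s t)"

lemma pair_digits_range: "1 \<le> k \<Longrightarrow> pair_digits s t k \<in> {0..3}"
  using binary_digit_range[of "k-1" s] binary_digit_range[of "k-1" t]
  by (auto simp: pair_digits_def split: nat.split)

text \<open>Codes closer than 1 / (2 * 8^K) agree in the digits 0 to \<open>K\<close>, hence in both
  integer parts and in the first \<open>K\<close> binary digits. The converse fails: close reals on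
  two sides of a dyadic point may have distant codes.\<close>

lemma pair_code_inverse:
  assumes "0 < e"
  shows "\<exists>d>0. \<forall>s t s' t'. \<bar>pair_code s t - pair_code s' t'\<bar> < d \<longrightarrow> \<bar>s - s'\<bar> < e \<and> \<bar>t - t'\<bar> < e"
proof -
  obtain K where K: "(1/2) ^ K < e" using real_arch_pow_inv[OF assms, of "1/2"] by auto
  have "\<bar>s - s'\<bar> < e \<and> \<bar>t - t'\<bar> < e"
    if *: "\<bar>pair_code s t - pair_code s' t'\<bar> < 1 / (2 * 8 ^ K)" for s t s' t'
  proof -
    have dig: "pair_digits s t k = pair_digits s' t' k" if "k \<le> K" for k
      using octal_digits_eq[OF pair_digits_range pair_digits_range *[unfolded pair_code_def] that] by simp
    have fl: "\<lfloor>s\<rfloor> = \<lfloor>s'\<rfloor>" "\<lfloor>t\<rfloor> = \<lfloor>t'\<rfloor>"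
      using dig[of 0] injD[OF inj_int_encode[of UNIV]] by (auto simp: pair_digits_def)
    have "binary_digit k s = binary_digit k s' \<and> binary_digit k t = binary_digit k t'" if "k < K" for k
      using dig[of "Suc k"] that binary_digit_range[of k s] binary_digit_range[of k t]
        binary_digit_range[of k s'] binary_digit_range[of k t'] by (auto simp: pair_digits_def)
    then have "\<bar>s - s'\<bar> < 1 / 2 ^ K \<and> \<bar>t - t'\<bar> < 1 / 2 ^ K"
      using abs_diff_less_of_binary_digits fl by blast
    then show ?thesis using K by (auto simp: power_divide)
  qed
  then show ?thesis by (intro exI[of _ "1 / (2 * 8 ^ K)"]) auto
qed

text \<open>The code is not continuous, so boundedness on a box comes from counting: the integer
  parts, hence the heads, take finitely many values, and the tail adds at most 3/7.\<close>

lemma pair_code_bounded: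
  "\<exists>B. \<forall>s t. \<bar>s\<bar> \<le> R \<longrightarrow> \<bar>t\<bar> \<le> S \<longrightarrow> \<bar>pair_code s t\<bar> \<le> B"
proof -
  define N where "N = (\<lambda>(a, b). prod_encode (int_encode a, int_encode b)) ` ({\<lfloor>-R\<rfloor>..\<lfloor>R\<rfloor>} \<times> {\<lfloor>-S\<rfloor>..\<lfloor>S\<rfloor>})"
  have fin: "finite N" unfolding N_def by blast
  have "\<bar>pair_code s t\<bar> \<le> real (Max N) + 1" if "\<bar>s\<bar> \<le> R" "\<bar>t\<bar> \<le> S" for s t
  proof -
    have "prod_encode (int_encode \<lfloor>s\<rfloor>, int_encode \<lfloor>t\<rfloor>) \<in> N"
      unfolding N_def using that by (intro image_eqI[of _ _ "(\<lfloor>s\<rfloor>, \<lfloor>t\<rfloor>)"]) (auto intro!: floor_mono)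
    then have "prod_encode (int_encode \<lfloor>s\<rfloor>, int_encode \<lfloor>t\<rfloor>) \<le> Max N" using fin by simp
    moreover have "0 \<le> octal_value (\<lambda>k. pair_digits s t (Suc k))" "octal_value (\<lambda>k. pair_digits s t (Suc k)) \<le> 24/7"
      by (rule octal_value_bounds; use pair_digits_range[of "Suc _"] in simp)+
    ultimately show ?thesis
      using octal_value_shift[of "pair_digits s t", OF pair_digits_range]
      by (simp add: pair_code_def pair_digits_def)
  qed
  then show ?thesis by blast
qed

lemma pair_code_measurable[measurable]: "(\<lambda>z. pair_code (fst z) (snd z)) \<in> borel_measurable (borel \<Otimes>\<^sub>M borel)"
proof -
  have "(\<lambda>z. real_of_int (pair_digits (fst z) (snd z) k)) \<in> borel_measurable (borel \<Otimes>\<^sub>M borel)" for k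
  proof (cases k)
    case 0
    show ?thesis unfolding pair_digits_def 0 by simp
  next
    case (Suc j)
    show ?thesis unfolding pair_digits_def Suc binary_digit_def by simp
  qed
  then show ?thesis unfolding pair_code_def octal_value_def by measurable
qed

text \<open>Coordinates are folded in one at a time; the second argument of \<open>pair_code\<close>
  is the code of the coordinates treated so far. Boundedness on balls will give tightness of the
  image laws. The last clause says that \<open>c\<close> is injective with uniformly continuous
  inverse.\<close>

lemma borel_code_exists:
  "\<exists>c :: 'a::euclidean_space \<Rightarrow> real. c \<in> borel_measurable borel
     \<and> (\<forall>R. \<exists>B. \<forall>x. norm x \<le> R \<longrightarrow> \<bar>c x\<bar> \<le> B)
     \<and> (\<forall>e>0. \<exists>d>0. \<forall>x y. \<bar>c x - c y\<bar> < d \<longrightarrow> dist x y < e)"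
proof -
  have list: "\<exists>c :: 'a \<Rightarrow> real. c \<in> borel_measurable borel
     \<and> (\<forall>R. \<exists>B. \<forall>x. norm x \<le> R \<longrightarrow> \<bar>c x\<bar> \<le> B)
     \<and> (\<forall>e>0. \<exists>d>0. \<forall>x y. \<bar>c x - c y\<bar> < d \<longrightarrow> (\<forall>b\<in>set bs. \<bar>x \<bullet> b - y \<bullet> b\<bar> < e))" 
    if "set bs \<subseteq> Basis" for bs :: "'a list"
    using that
  proof (induction bs)
    case Nil
    show ?case by (rule exI[of _ "\<lambda>_. 0"]) (auto intro: exI[of _ 1])
  next
    case (Cons b bs)
    then obtain c :: "'a \<Rightarrow> real" where c[measurable]: "c \<in> borel_measurable borel"
      and cb: "\<And>R. \<exists>B. \<forall>x. norm x \<le> R \<longrightarrow> \<bar>c x\<bar> \<le> B"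
      and ci: "\<And>e. e > 0 \<Longrightarrow> \<exists>d>0. \<forall>x y. \<bar>c x - c y\<bar> < d \<longrightarrow> (\<forall>b\<in>set bs. \<bar>x \<bullet> b - y \<bullet> b\<bar> < e)"
      by auto
    define c' where "c' x = pair_code (x \<bullet> b) (c x)" for x
    have "c' \<in> borel_measurable borel"
    proof -
      have "(\<lambda>x. (x \<bullet> b, c x)) \<in> borel \<rightarrow>\<^sub>M borel \<Otimes>\<^sub>M borel" by measurable
      from measurable_compose[OF this pair_code_measurable] show ?thesis
        unfolding c'_def by simp
    qed
    moreover have "\<exists>B. \<forall>x. norm x \<le> R \<longrightarrow> \<bar>c' x\<bar> \<le> B" for R
    proof -
      obtain S where S: "\<And>x. norm x \<le> R \<Longrightarrow> \<bar>c x\<bar> \<le> S" using cb[of R] by auto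
      obtain B where B: "\<And>s t. \<bar>s\<bar> \<le> R \<Longrightarrow> \<bar>t\<bar> \<le> S \<Longrightarrow> \<bar>pair_code s t\<bar> \<le> B"
        using pair_code_bounded[of R S] by auto
      have "\<bar>x \<bullet> b\<bar> \<le> R" if "norm x \<le> R" for x
        using Basis_le_norm[of b x] Cons.prems that by auto
      then show ?thesis unfolding c'_def using B S by blast
    qed
    moreover have "\<exists>d>0. \<forall>x y. \<bar>c' x - c' y\<bar> < d \<longrightarrow> (\<forall>b\<in>set (b # bs). \<bar>x \<bullet> b - y \<bullet> b\<bar> < e)" if e: "e > 0" for e
    proof -
      obtain d1 where d1: "d1 > 0" "\<And>x y. \<bar>c x - c y\<bar> < d1 \<Longrightarrow> (\<forall>b\<in>set bs. \<bar>x \<bullet> b - y \<bullet> b\<bar> < e)"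
        using ci[OF e] by auto
      \<comment> \<open>The new code has to determine the new coordinate within \<open>e\<close> and
        the old code within \<open>d1\<close>, which in turn controls the earlier
        coordinates.\<close>
      obtain d where d: "d > 0" "\<And>s t s' t'. \<bar>pair_code s t - pair_code s' t'\<bar> < d \<Longrightarrow> \<bar>s - s'\<bar> < min d1 e \<and> \<bar>t - t'\<bar> < min d1 e"
        using pair_code_inverse[of "min d1 e"] d1(1) e by auto
      show ?thesis
      proof (intro exI[of _ d] conjI allI impI d(1))
        fix x y assume "\<bar>c' x - c' y\<bar> < d"
        then have "\<bar>x \<bullet> b - y \<bullet> b\<bar> < min d1 e \<and> \<bar>c x - c y\<bar> < min d1 e"
          unfolding c'_def by (rule d(2))
        then show "\<forall>b\<in>set (b # bs). \<bar>x \<bullet> b - y \<bullet> b\<bar> < e" using d1(2)[of x y] by auto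
      qed
    qed
    ultimately show ?case by blast
  qed
  obtain bs :: "'a list" where bs: "set bs = Basis" using finite_list[OF finite_Basis] by blast
  obtain c :: "'a \<Rightarrow> real" where c: "c \<in> borel_measurable borel"
    "\<forall>R. \<exists>B. \<forall>x. norm x \<le> R \<longrightarrow> \<bar>c x\<bar> \<le> B"
    and ci: "\<And>e. e > 0 \<Longrightarrow> \<exists>d>0. \<forall>x y. \<bar>c x - c y\<bar> < d \<longrightarrow> (\<forall>b\<in>Basis. \<bar>x \<bullet> b - y \<bullet> b\<bar> < e)"
    using list[of bs] bs by auto
  have "\<exists>d>0. \<forall>x y. \<bar>c x - c y\<bar> < d \<longrightarrow> dist x y < e" if e: "e > 0" for e
  proof -
    obtain d where d: "d > 0" "\<And>x y. \<bar>c x - c y\<bar> < d \<Longrightarrow> \<forall>b\<in>Basis. \<bar>x \<bullet> b - y \<bullet> b\<bar> < e / DIM('a)"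
      using ci[of "e / DIM('a)"] e by auto
    have "dist x y < e" if "\<bar>c x - c y\<bar> < d" for x y
    proof -
      have "dist x y \<le> (\<Sum>b\<in>Basis. \<bar>(x - y) \<bullet> b\<bar>)"
        unfolding dist_norm by (rule norm_le_l1)
      also have "\<dots> < (\<Sum>b\<in>(Basis::'a set). e / DIM('a))"
        using d(2)[OF that] by (intro sum_strict_mono) (auto simp: inner_diff_left)
      finally show ?thesis by simp
    qed
    then show ?thesis using d(1) by blast
  qed
  then show ?thesis using c by blast
qed


section \<open>Convergence in quadratic mean\<close>

text \<open>Young's inequality with a free weight \<open>t\<close>; optimizing over \<open>t\<close>
  later yields Minkowski's inequality.\<close>

lemma norm_add_sq_le:
  fixes x y :: "'b::real_inner"
  assumes "0 < t"
  shows "(norm (x + y))\<^sup>2 \<le> (1 + t) * (norm x)\<^sup>2 + (1 + 1 / t) * (norm y)\<^sup>2"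
proof -
  have "0 \<le> (sqrt t * norm x - norm y / sqrt t)\<^sup>2" by simp
  also have "\<dots> = t * (norm x)\<^sup>2 + (norm y)\<^sup>2 / t - 2 * (norm x * norm y)"
    using assms by (simp add: power2_diff power_mult_distrib power_divide)
  finally have "2 * (norm x * norm y) \<le> t * (norm x)\<^sup>2 + (norm y)\<^sup>2 / t" by simp
  moreover have "(norm (x + y))\<^sup>2 \<le> (norm x + norm y)\<^sup>2"
    by (intro power_mono norm_triangle_ineq) simp
  ultimately show ?thesis by (simp add: power2_sum algebra_simps)
qed

lemma integrable_norm_sq_add:
  fixes f g :: "'m \<Rightarrow> 'b::euclidean_space"
  assumes [measurable]: "f \<in> borel_measurable M" "g \<in> borel_measurable M"
    and "integrable M (\<lambda>x. (norm (f x))\<^sup>2)" "integrable M (\<lambda>x. (norm (g x))\<^sup>2)"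
  shows "integrable M (\<lambda>x. (norm (f x + g x))\<^sup>2)"
proof (rule Bochner_Integration.integrable_bound)
  show "integrable M (\<lambda>x. 2 * (norm (f x))\<^sup>2 + 2 * (norm (g x))\<^sup>2)"
    using assms by simp
  show "AE x in M. norm ((norm (f x + g x))\<^sup>2) \<le> norm (2 * (norm (f x))\<^sup>2 + 2 * (norm (g x))\<^sup>2)"
    using norm_add_sq_le[of 1] by (auto simp: abs_of_nonneg)
qed simp

lemma integrable_norm_sq_diff:
  fixes f g :: "'m \<Rightarrow> 'b::euclidean_space"
  assumes "f \<in> borel_measurable M" "g \<in> borel_measurable M"
    and "integrable M (\<lambda>x. (norm (f x))\<^sup>2)" "integrable M (\<lambda>x. (norm (g x))\<^sup>2)"
  shows "integrable M (\<lambda>x. (norm (f x - g x))\<^sup>2)"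
  using integrable_norm_sq_add[of f M "\<lambda>x. - g x"] assms by simp

text \<open>If a and b are the two L2 norms, the pointwise bound \<open>norm_add_sq_le\<close> with
  weight t = b / a integrates to exactly (a + b)^2.\<close>

lemma L2_minkowski:
  fixes f g :: "'m \<Rightarrow> 'b::euclidean_space"
  assumes [measurable]: "f \<in> borel_measurable M" "g \<in> borel_measurable M"
    and if2: "integrable M (\<lambda>x. (norm (f x))\<^sup>2)" and ig2: "integrable M (\<lambda>x. (norm (g x))\<^sup>2)"
  shows "sqrt (\<integral>x. (norm (f x + g x))\<^sup>2 \<partial>M)
    \<le> sqrt (\<integral>x. (norm (f x))\<^sup>2 \<partial>M) + sqrt (\<integral>x. (norm (g x))\<^sup>2 \<partial>M)"
proof (rule field_le_epsilon)
  fix e :: real assume e: "0 < e"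
  define A where "A = (\<integral>x. (norm (f x))\<^sup>2 \<partial>M)"
  define B where "B = (\<integral>x. (norm (g x))\<^sup>2 \<partial>M)"
  \<comment> \<open>The extra \<open>e / 2\<close> keeps \<open>a\<close> and \<open>b\<close>
    positive, so that the weight \<open>b / a\<close> makes sense even when a function vanishes
    almost everywhere.\<close>
  define a where "a = sqrt A + e / 2"
  define b where "b = sqrt B + e / 2"
  have AB: "0 \<le> A" "0 \<le> B" unfolding A_def B_def by (simp_all add: integral_nonneg_AE)
  have pos: "0 < a" "0 < b" unfolding a_def b_def using e AB by (simp_all add: add_nonneg_pos)
  have "A = (sqrt A)\<^sup>2" "B = (sqrt B)\<^sup>2" using AB by simp_all
  then have le: "A \<le> a\<^sup>2" "B \<le> b\<^sup>2"
    using e AB power_mono[of "sqrt A" a 2] power_mono[of "sqrt B" b 2]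
    unfolding a_def b_def by auto
  have "(\<integral>x. (norm (f x + g x))\<^sup>2 \<partial>M)
      \<le> (\<integral>x. (1 + b / a) * (norm (f x))\<^sup>2 + (1 + 1 / (b / a)) * (norm (g x))\<^sup>2 \<partial>M)"
    by (intro integral_mono norm_add_sq_le integrable_norm_sq_add) (use assms pos in auto)
  also have "\<dots> = (1 + b / a) * A + (1 + a / b) * B"
    using if2 ig2 by (simp add: A_def B_def)
  also have "\<dots> \<le> (1 + b / a) * a\<^sup>2 + (1 + a / b) * b\<^sup>2"
    using le pos by (intro add_mono mult_left_mono) auto
  also have "\<dots> = (a + b)\<^sup>2"
    using pos by (simp add: power2_eq_square field_simps)
  finally have "sqrt (\<integral>x. (norm (f x + g x))\<^sup>2 \<partial>M) \<le> a + b"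
    using pos by (simp add: real_le_lsqrt)
  then show "sqrt (\<integral>x. (norm (f x + g x))\<^sup>2 \<partial>M)
    \<le> sqrt (\<integral>x. (norm (f x))\<^sup>2 \<partial>M) + sqrt (\<integral>x. (norm (g x))\<^sup>2 \<partial>M) + e"
    by (simp add: a_def b_def A_def B_def)
qed

lemma L2_minkowski_diff:
  fixes f g :: "'m \<Rightarrow> 'b::euclidean_space"
  assumes "f \<in> borel_measurable M" "g \<in> borel_measurable M"
    and "integrable M (\<lambda>x. (norm (f x))\<^sup>2)" "integrable M (\<lambda>x. (norm (g x))\<^sup>2)"
  shows "sqrt (\<integral>x. (norm (f x - g x))\<^sup>2 \<partial>M)
    \<le> sqrt (\<integral>x. (norm (f x))\<^sup>2 \<partial>M) + sqrt (\<integral>x. (norm (g x))\<^sup>2 \<partial>M)"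
  using L2_minkowski[of f M "\<lambda>x. - g x"] assms by simp

lemma (in prob_space) integrable_of_norm_sq:
  fixes f :: "'a \<Rightarrow> 'b::euclidean_space"
  assumes [measurable]: "f \<in> borel_measurable M" and "integrable M (\<lambda>x. (norm (f x))\<^sup>2)"
  shows "integrable M f"
proof (rule Bochner_Integration.integrable_bound)
  show "integrable M (\<lambda>x. 1 + (norm (f x))\<^sup>2)" using assms by simp
  have "norm (f x) \<le> 1 + (norm (f x))\<^sup>2" for x
  proof -
    have "2 * norm (f x) \<le> (norm (f x))\<^sup>2 + 1"
      using zero_le_power2[of "norm (f x) - 1"] by (simp add: power2_diff)
    then show ?thesis using norm_ge_zero[of "f x"] by linarith
  qed
  then show "AE x in M. norm (f x) \<le> norm (1 + (norm (f x))\<^sup>2)"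
    by (auto simp: abs_of_nonneg)
qed simp

text \<open>This is nonnegativity of the variance of the norm.\<close>

lemma (in prob_space) expectation_norm_le_L2:
  fixes f :: "'a \<Rightarrow> 'b::euclidean_space"
  assumes [measurable]: "f \<in> borel_measurable M" and i: "integrable M (\<lambda>x. (norm (f x))\<^sup>2)"
  shows "(\<integral>x. norm (f x) \<partial>M) \<le> sqrt (\<integral>x. (norm (f x))\<^sup>2 \<partial>M)"
proof -
  have 1: "integrable M (\<lambda>x. norm (f x))" using integrable_of_norm_sq[OF assms] by simp
  have "0 \<le> variance (\<lambda>x. norm (f x))" by (simp add: integral_nonneg_AE)
  also have "\<dots> = expectation (\<lambda>x. (norm (f x))\<^sup>2) - (expectation (\<lambda>x. norm (f x)))\<^sup>2"
    using 1 i by (rule variance_eq)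
  finally show ?thesis by (intro real_le_rsqrt) simp
qed

text \<open>The bound \<open>a n\<close> may vary with n: when convex order passes to the limit, the
  integrands are made nonnegative by adding a multiple of 1 + |x|, whose integral depends on n.
  Integrability of the limit is part of the conclusion.\<close>

lemma integral_fatou:
  fixes u :: "nat \<Rightarrow> 'm \<Rightarrow> real"
  assumes int: "\<And>n. integrable M (u n)" and v[measurable]: "v \<in> borel_measurable M"
    and nn: "\<And>n. AE x in M. 0 \<le> u n x"
    and lim: "AE x in M. (\<lambda>n. u n x) \<longlonglongrightarrow> v x"
    and le: "\<And>n. (\<integral>x. u n x \<partial>M) \<le> a n" and a: "a \<longlonglongrightarrow> A"
  shows "integrable M v \<and> (\<integral>x. v x \<partial>M) \<le> A"
proof
  have u[measurable]: "u n \<in> borel_measurable M" for n using int by auto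
  have nnall: "AE x in M. \<forall>n. 0 \<le> u n x" using nn by (simp add: AE_all_countable)
  have vnn: "AE x in M. 0 \<le> v x"
    using nnall lim by eventually_elim (auto intro: LIMSEQ_le_const)
  have an: "0 \<le> a n" for n
    using le[of n] integral_nonneg_AE[OF nn[of n]] by linarith
  have A: "0 \<le> A" using a an by (intro LIMSEQ_le_const[OF a]) auto
  have "(\<integral>\<^sup>+x. ennreal (v x) \<partial>M) = (\<integral>\<^sup>+x. liminf (\<lambda>n. ennreal (u n x)) \<partial>M)"
  proof (rule nn_integral_cong_AE)
    show "AE x in M. ennreal (v x) = liminf (\<lambda>n. ennreal (u n x))"
      using lim by eventually_elim (auto intro!: lim_imp_Liminf[symmetric] tendsto_ennrealI)
  qed
  also have "\<dots> \<le> liminf (\<lambda>n. \<integral>\<^sup>+x. ennreal (u n x) \<partial>M)"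
    by (rule nn_integral_liminf) simp
  also have "\<dots> \<le> liminf (\<lambda>n. ennreal (a n))"
    using le by (intro Liminf_mono always_eventually allI)
      (simp add: nn_integral_eq_integral[OF int nn] ennreal_leI)
  also have "\<dots> = ennreal A"
    by (intro lim_imp_Liminf tendsto_ennrealI a) simp
  finally have *: "(\<integral>\<^sup>+x. ennreal (v x) \<partial>M) \<le> ennreal A" .
  show i: "integrable M v"
    using * vnn by (intro integrableI_nonneg) (auto simp: order_le_less_trans)
  show "(\<integral>x. v x \<partial>M) \<le> A"
    using * A unfolding nn_integral_eq_integral[OF i vnn] by simp
qed

section \<open>Projection onto balls and uniform integrability of squares\<close>

definition radial_excess :: "real \<Rightarrow> 'b::real_normed_vector \<Rightarrow> real" where
  "radial_excess R x = (max 0 (norm x - R))\<^sup>2"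

text \<open>For 0 < R this is the metric projection onto the closed ball of radius \<open>R\<close>;
  the \<open>max\<close> gives one continuous formula without a case split. The squared distance
  moved is \<open>radial_excess R x\<close>.\<close>

definition radial_truncation :: "real \<Rightarrow> 'b::real_normed_vector \<Rightarrow> 'b" where
  "radial_truncation R x = (R / max R (norm x)) *\<^sub>R x"

lemma radial_excess_nonneg[simp]: "0 \<le> radial_excess R x"
  by (simp add: radial_excess_def)

lemma radial_truncation_norm: "0 < R \<Longrightarrow> norm (radial_truncation R x) \<le> R"
  by (auto simp: radial_truncation_def max_def field_simps)

lemma norm_diff_radial_truncation:
  assumes "0 < R"
  shows "(norm (x - radial_truncation R x))\<^sup>2 = radial_excess R x"
proof (cases "norm x \<le> R")
  case False
  have "x - radial_truncation R x = (1 - R / norm x) *\<^sub>R x"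
    using False by (simp add: radial_truncation_def max_def scaleR_diff_left)
  then have "norm (x - radial_truncation R x) = \<bar>1 - R / norm x\<bar> * norm x" by simp
  also have "\<dots> = norm x - R"
  proof -
    have "0 < norm x" "R / norm x \<le> 1" using False assms by (auto simp del: zero_less_norm_iff)
    then show ?thesis by (auto simp: left_diff_distrib)
  qed
  finally show ?thesis using False by (simp add: radial_excess_def max_def)
qed (use assms in \<open>auto simp: radial_excess_def radial_truncation_def max_def\<close>)

lemma continuous_radial_truncation: "0 < R \<Longrightarrow> continuous_on UNIV (radial_truncation R)"
  unfolding radial_truncation_def
  by (intro continuous_intros) (auto simp: max_def)

lemma continuous_radial_excess: "continuous_on UNIV (radial_excess R)"
  unfolding radial_excess_def by (intro continuous_intros)

lemma norm_sq_le_radial_excess: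
  assumes "0 \<le> R" shows "(norm x)\<^sup>2 \<le> 2 * R\<^sup>2 + 2 * radial_excess R x"
proof -
  have "(norm x)\<^sup>2 \<le> (R + max 0 (norm x - R))\<^sup>2" using assms by (intro power_mono) auto
  also have "\<dots> \<le> 2 * R\<^sup>2 + 2 * (max 0 (norm x - R))\<^sup>2"
    using norm_add_sq_le[of 1 R "max 0 (norm x - R)"] by simp
  finally show ?thesis by (simp add: radial_excess_def)
qed

lemma radial_excess_le: "0 \<le> R \<Longrightarrow> radial_excess R x \<le> (norm x)\<^sup>2"
  unfolding radial_excess_def by (intro power_mono) auto

text \<open>The positive part of |x| - R is convex, and squaring is convex and increasing on
  nonnegative reals.\<close>

lemma convex_radial_excess: "convex_on UNIV (radial_excess R :: 'b::real_normed_vector \<Rightarrow> real)"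
proof (rule convex_onI)
  fix t :: real and x y :: 'b assume t: "0 < t" "t < 1"
  let ?p = "\<lambda>x::'b. max 0 (norm x - R)"
  have "norm ((1 - t) *\<^sub>R x + t *\<^sub>R y) \<le> (1 - t) * norm x + t * norm y"
    using t norm_triangle_ineq[of "(1 - t) *\<^sub>R x" "t *\<^sub>R y"] by simp
  then have "norm ((1 - t) *\<^sub>R x + t *\<^sub>R y) - R \<le> (1 - t) * (norm x - R) + t * (norm y - R)"
    by (simp add: algebra_simps)
  also have "\<dots> \<le> (1 - t) * ?p x + t * ?p y"
    using t by (intro add_mono mult_left_mono) auto
  finally have "?p ((1 - t) *\<^sub>R x + t *\<^sub>R y) \<le> (1 - t) * ?p x + t * ?p y"
    using t by simp
  then have "(?p ((1 - t) *\<^sub>R x + t *\<^sub>R y))\<^sup>2 \<le> ((1 - t) * ?p x + t * ?p y)\<^sup>2"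
    by (intro power_mono) auto
  also have "\<dots> \<le> (1 - t) * (?p x)\<^sup>2 + t * (?p y)\<^sup>2"
    using convex_onD[OF convex_power2, of t "?p x" "?p y"] t by simp
  finally show "radial_excess R ((1 - t) *\<^sub>R x + t *\<^sub>R y) \<le> (1 - t) * radial_excess R x + t * radial_excess R y"
    by (simp add: radial_excess_def)
qed simp

text \<open>A Vitali theorem in which uniform integrability is expressed by radial excess.
  Truncations converge by bounded convergence, and the cost of truncating is small uniformly in
  n.\<close>

lemma (in prob_space) L2_convergence_of_radial_excess:
  fixes X :: "nat \<Rightarrow> 'a \<Rightarrow> 'b::euclidean_space"
  assumes X[measurable]: "\<And>n. X n \<in> borel_measurable M" and Y[measurable]: "Y \<in> borel_measurable M"
    and lim: "AE w in M. (\<lambda>n. X n w) \<longlonglongrightarrow> Y w"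
    and X2: "\<And>n. integrable M (\<lambda>w. (norm (X n w))\<^sup>2)"
    and unif: "\<And>e. 0 < e \<Longrightarrow> \<exists>R>0. \<forall>n. (\<integral>w. radial_excess R (X n w) \<partial>M) \<le> e"
  shows "integrable M (\<lambda>w. (norm (Y w))\<^sup>2)" "(\<lambda>n. \<integral>w. (norm (X n w - Y w))\<^sup>2 \<partial>M) \<longlonglongrightarrow> 0"
proof -
  have ex[measurable]: "radial_excess R \<in> borel_measurable borel" for R :: real
    using continuous_radial_excess by (rule borel_measurable_continuous_onI)
  have iX: "integrable M (\<lambda>w. radial_excess R (X n w))" if "0 < R" for R n
    by (rule Bochner_Integration.integrable_bound[OF X2[of n]]) (use radial_excess_le[of R] that in \<open>auto simp: less_imp_le\<close>)
  have limex: "AE w in M. (\<lambda>n. radial_excess R (X n w)) \<longlonglongrightarrow> radial_excess R (Y w)" for R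
    using lim by eventually_elim
      (rule continuous_on_tendsto_compose[OF continuous_radial_excess[of R]], auto)
  \<comment> \<open>Fatou's lemma hands the uniform excess bound on to the limit
    \<open>Y\<close>.\<close>
  have "integrable M (\<lambda>w. radial_excess R (Y w)) \<and> (\<integral>w. radial_excess R (Y w) \<partial>M) \<le> e"
    if "0 < R" "\<forall>n. (\<integral>w. radial_excess R (X n w) \<partial>M) \<le> e" for R e
    using integral_fatou[OF iX[OF that(1)] _ _ limex[of R], of "\<lambda>_. e" e] that(2) by auto
  then have iY: "integrable M (\<lambda>w. radial_excess R (Y w))" "(\<integral>w. radial_excess R (Y w) \<partial>M) \<le> e"
    if "0 < R" "\<forall>n. (\<integral>w. radial_excess R (X n w) \<partial>M) \<le> e" for R e
    using that by auto
  obtain R1 where R1: "0 < R1" "\<forall>n. (\<integral>w. radial_excess R1 (X n w) \<partial>M) \<le> 1"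
    using unif[of 1] by auto
  show Y2: "integrable M (\<lambda>w. (norm (Y w))\<^sup>2)"
  proof (rule Bochner_Integration.integrable_bound)
    show "integrable M (\<lambda>w. 2 * R1\<^sup>2 + 2 * radial_excess R1 (Y w))" using iY(1)[OF R1] by simp
    show "AE w in M. norm ((norm (Y w))\<^sup>2) \<le> norm (2 * R1\<^sup>2 + 2 * radial_excess R1 (Y w))"
      using norm_sq_le_radial_excess[of R1] R1(1) by (auto simp: abs_of_nonneg less_imp_le)
  qed simp
  show "(\<lambda>n. \<integral>w. (norm (X n w - Y w))\<^sup>2 \<partial>M) \<longlonglongrightarrow> 0"
  proof (rule LIMSEQ_I)
    fix e :: real assume e: "0 < e"
    \<comment> \<open>With the coefficients 4, 4 and 2 of the pointwise bound below, excesses of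
      e/18 and a truncated distance below e/9 add up to 2e/3.\<close>
    obtain R where R: "0 < R" "\<forall>n. (\<integral>w. radial_excess R (X n w) \<partial>M) \<le> e / 18"
      using unif[of "e / 18"] e by auto
    define T where "T = (radial_truncation R :: 'b \<Rightarrow> 'b)"
    have T[measurable]: "T \<in> borel_measurable borel"
      unfolding T_def using continuous_radial_truncation[OF R(1)] by (rule borel_measurable_continuous_onI)
    have Tb: "(norm (T x - T y))\<^sup>2 \<le> (2 * R)\<^sup>2" for x y
    proof (intro power_mono)
      show "norm (T x - T y) \<le> 2 * R"
        using norm_triangle_ineq4[of "T x" "T y"] radial_truncation_norm[OF R(1), of x]
          radial_truncation_norm[OF R(1), of y] unfolding T_def by linarith
    qed simp
    have "(\<lambda>n. \<integral>w. (norm (T (X n w) - T (Y w)))\<^sup>2 \<partial>M) \<longlonglongrightarrow> (\<integral>w. 0 \<partial>M)"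
    proof (rule integral_dominated_convergence[where w="\<lambda>_. (2 * R)\<^sup>2"])
      show "AE w in M. (\<lambda>n. (norm (T (X n w) - T (Y w)))\<^sup>2) \<longlonglongrightarrow> 0"
        using lim
      proof eventually_elim
        case (elim w)
        have "(\<lambda>n. T (X n w)) \<longlonglongrightarrow> T (Y w)"
          unfolding T_def using continuous_on_tendsto_compose[OF continuous_radial_truncation[OF R(1)] elim] by simp
        then have "(\<lambda>n. (norm (T (X n w) - T (Y w)))\<^sup>2) \<longlonglongrightarrow> (norm (T (Y w) - T (Y w)))\<^sup>2"
          by (intro tendsto_intros)
        then show ?case by simp
      qed
    qed (use Tb in auto)
    then have "eventually (\<lambda>n. (\<integral>w. (norm (T (X n w) - T (Y w)))\<^sup>2 \<partial>M) < e / 9) sequentially"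
      using order_tendstoD(2)[of _ _ _ "e/9"] e by force
    then obtain N where N: "\<And>n. N \<le> n \<Longrightarrow> (\<integral>w. (norm (T (X n w) - T (Y w)))\<^sup>2 \<partial>M) < e / 9"
      by (auto simp: eventually_sequentially)
    have "norm ((\<integral>w. (norm (X n w - Y w))\<^sup>2 \<partial>M) - 0) < e" if n: "N \<le> n" for n
    proof -
      have iT: "integrable M (\<lambda>w. (norm (T (X n w) - T (Y w)))\<^sup>2)"
        by (rule integrable_const_bound[where B="(2 * R)\<^sup>2"]) (use Tb in auto)
      \<comment> \<open>Young's inequality with weight 1, applied twice to x - y = ((x - T x) + (T y
        - y)) + (T x - T y).\<close>
      have pt: "(norm (x - y))\<^sup>2 \<le> 4 * radial_excess R x + 4 * radial_excess R y + 2 * (norm (T x - T y))\<^sup>2" for x y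
      proof -
        have "(norm (x - y))\<^sup>2 \<le> 2 * (norm ((x - T x) + (T y - y)))\<^sup>2 + 2 * (norm (T x - T y))\<^sup>2"
          using norm_add_sq_le[of 1 "(x - T x) + (T y - y)" "T x - T y"] by simp
        moreover have "(norm ((x - T x) + (T y - y)))\<^sup>2 \<le> 2 * (norm (x - T x))\<^sup>2 + 2 * (norm (T y - y))\<^sup>2"
          using norm_add_sq_le[of 1 "x - T x" "T y - y"] by simp
        ultimately show ?thesis
          using norm_diff_radial_truncation[OF R(1), of x] norm_diff_radial_truncation[OF R(1), of y]
          by (simp add: T_def norm_minus_commute)
      qed
      have "(\<integral>w. (norm (X n w - Y w))\<^sup>2 \<partial>M) \<le>
        (\<integral>w. 4 * radial_excess R (X n w) + 4 * radial_excess R (Y w) + 2 * (norm (T (X n w) - T (Y w)))\<^sup>2 \<partial>M)"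
        using iX[OF R(1)] iY(1)[OF R] iT X2 Y2
        by (intro integral_mono pt) (auto intro!: integrable_norm_sq_diff)
      also have "\<dots> = 4 * (\<integral>w. radial_excess R (X n w) \<partial>M) + 4 * (\<integral>w. radial_excess R (Y w) \<partial>M)
          + 2 * (\<integral>w. (norm (T (X n w) - T (Y w)))\<^sup>2 \<partial>M)"
        using iX[OF R(1)] iY(1)[OF R] iT by simp
      also have "\<dots> < 4 * (e / 18) + 4 * (e / 18) + 2 * (e / 9)"
        using R(2)[rule_format, of n] iY(2)[OF R] N[OF n] by linarith
      also have "\<dots> < e" using e by simp
      finally show ?thesis by (simp add: integral_nonneg_AE)
    qed
    then show "\<exists>N. \<forall>n\<ge>N. norm ((\<integral>w. (norm (X n w - Y w))\<^sup>2 \<partial>M) - 0) < e" by blast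
  qed
qed


section \<open>Almost sure representation of subsequences\<close>

lemma P2_iff: "\<mu> \<in> P2 \<longleftrightarrow> sets \<mu> = sets borel \<and> prob_space \<mu> \<and> integrable \<mu> (\<lambda>x. (norm x)\<^sup>2)"
  by (simp add: P2_def)

text \<open>By Chebyshev's inequality and boundedness of the code on balls, the coded laws are tight
  on the line. After Helly and Skorohod, the extended inverse of the code turns convergence of codes
  into convergence of points.\<close>

lemma Skorohod_subsequence:
  fixes \<mu> :: "nat \<Rightarrow> 'a::euclidean_space measure"
  assumes P2: "\<And>n. \<mu> n \<in> P2" and K: "\<And>n. (\<integral>x. (norm x)\<^sup>2 \<partial>\<mu> n) \<le> K"
  obtains r \<Omega> X Y where "strict_mono (r :: nat \<Rightarrow> nat)" "prob_space (\<Omega> :: real measure)"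
    "\<And>n. X n \<in> borel_measurable \<Omega>" "Y \<in> borel_measurable \<Omega>"
    "\<And>n. distr \<Omega> borel (X n) = \<mu> (r n)" "AE w in \<Omega>. (\<lambda>n. X n w) \<longlonglongrightarrow> Y w"
proof -
  have sets[measurable_cong, simp]: "sets (\<mu> n) = sets borel" and prob: "prob_space (\<mu> n)"
    and int: "integrable (\<mu> n) (\<lambda>x. (norm x)\<^sup>2)" for n
    using P2[of n] by (auto simp: P2_iff)
  obtain c :: "'a \<Rightarrow> real" where c[measurable]: "c \<in> borel_measurable borel"
    and cb: "\<And>R. \<exists>B. \<forall>x. norm x \<le> R \<longrightarrow> \<bar>c x\<bar> \<le> B"
    and ci: "\<And>e. e > 0 \<Longrightarrow> \<exists>d>0. \<forall>x y. \<bar>c x - c y\<bar> < d \<longrightarrow> dist x y < e"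
    using borel_code_exists by blast
  define L where "L n = distr (\<mu> n) borel c" for n
  have L: "real_distribution (L n)" for n
    unfolding L_def by (rule prob_space.real_distribution_distr[OF prob]) simp
  have "tight L"
    unfolding tight_def
  proof (intro conjI allI impI L)
    fix e :: real assume e: "0 < e"
    have K0: "0 \<le> K" by (rule order_trans[OF _ K[of 0]]) simp
    \<comment> \<open>The numerator K + 1 keeps \<open>R\<close> positive when K = 0 and makes K /
      R^2 < e strict.\<close>
    define R where "R = sqrt ((K + 1) / e)"
    have R: "0 < R" "R\<^sup>2 = (K + 1) / e" using e K0 by (auto simp: R_def)
    obtain B where B: "\<And>x. norm x \<le> R \<Longrightarrow> \<bar>c x\<bar> \<le> B" using cb[of R] by auto
    \<comment> \<open>Tightness is phrased with half-open intervals: starting at -B - 1 includes the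
      value -B and keeps the interval nonempty when B = 0.\<close>
    have "measure (L n) {-B - 1<..B} > 1 - e" for n
    proof -
      interpret prob_space "\<mu> n" by (rule prob)
      have "prob {x \<in> space (\<mu> n). R\<^sup>2 \<le> (norm x)\<^sup>2} \<le> (\<integral>x. (norm x)\<^sup>2 \<partial>\<mu> n) / R\<^sup>2"
        using R(1) by (intro integral_Markov_inequality_measure[where A="{}"] int) auto
      also have "\<dots> \<le> K / R\<^sup>2" using K R(1) by (intro divide_right_mono) auto
      also have "\<dots> < e" unfolding R(2) using e K0 by (simp add: field_simps)
      finally have "prob (space (\<mu> n) - {x \<in> space (\<mu> n). R\<^sup>2 \<le> (norm x)\<^sup>2}) > 1 - e"
        by (subst prob_compl) auto
      also have "prob (space (\<mu> n) - {x \<in> space (\<mu> n). R\<^sup>2 \<le> (norm x)\<^sup>2}) \<le> prob (c -` {-B - 1<..B} \<inter> space (\<mu> n))"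
      proof (rule finite_measure_mono)
        show "space (\<mu> n) - {x \<in> space (\<mu> n). R\<^sup>2 \<le> (norm x)\<^sup>2} \<subseteq> c -` {-B - 1<..B} \<inter> space (\<mu> n)"
        proof
          fix x assume x: "x \<in> space (\<mu> n) - {x \<in> space (\<mu> n). R\<^sup>2 \<le> (norm x)\<^sup>2}"
          then have "norm x \<le> R" using R(1) power_mono[of R "norm x" 2] by force
          from B[OF this] x show "x \<in> c -` {-B - 1<..B} \<inter> space (\<mu> n)" by auto
        qed
      qed simp
      also have "\<dots> = measure (L n) {-B - 1<..B}" unfolding L_def by (subst measure_distr) auto
      finally show ?thesis .
    qed
    moreover have "-B - 1 < B" using B[of 0] R(1) by simp
    ultimately show "\<exists>a b. a < b \<and> (\<forall>n. measure (L n) {a<..b} > 1 - e)" by blast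
  qed
  from tight_imp_convergent_subsubsequence[OF this strict_mono_id]
  obtain r M where r: "strict_mono r" and M: "real_distribution M" and wc: "weak_conv_m (\<lambda>n. L (r n)) M"
    by (auto simp: comp_def)
  from Skorohod[OF L M wc] obtain \<Omega> :: "real measure" and Y' Y where \<Omega>: "prob_space \<Omega>"
    and Y'[measurable]: "\<And>n. Y' n \<in> borel_measurable \<Omega>" and dY': "\<And>n. distr \<Omega> borel (Y' n) = L (r n)"
    and Y[measurable]: "Y \<in> borel_measurable \<Omega>"
    and lim: "\<And>w. w \<in> space \<Omega> \<Longrightarrow> (\<lambda>n. Y' n w) \<longlonglongrightarrow> Y w"
    by force
  have inj: "inj c"
  proof (rule injI)
    fix x y assume "c x = c y"
    then have "dist x y < e" if "e > 0" for e using ci[OF that] by auto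
    then show "x = y" using zero_less_dist_iff[of x y] by blast
  qed
  have "uniformly_continuous_on (range c) (inv c)"
    unfolding uniformly_continuous_on_def
  proof (intro allI impI)
    fix e :: real assume "0 < e"
    then obtain d where "d > 0" "\<And>x y. \<bar>c x - c y\<bar> < d \<Longrightarrow> dist x y < e" using ci by blast
    then show "\<exists>d>0. \<forall>x\<in>range c. \<forall>x'\<in>range c. dist x' x < d \<longrightarrow> dist (inv c x') (inv c x) < e"
      using inj by (intro exI[of _ d]) (auto simp: dist_real_def)
  qed
  then obtain g0 where g0: "uniformly_continuous_on (closure (range c)) g0" "\<And>t. t \<in> range c \<Longrightarrow> inv c t = g0 t"
    using uniformly_continuous_on_extension_on_closure by metis
  \<comment> \<open>The default value 0 is harmless: almost surely all \<open>Y' n\<close>, and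
    hence their limit \<open>Y\<close>, lie in the closure.\<close>
  define g where "g t = (if t \<in> closure (range c) then g0 t else 0)" for t
  have g[measurable]: "g \<in> borel_measurable borel"
    unfolding g_def
    by (rule borel_measurable_continuous_on_if) (auto intro: uniformly_continuous_imp_continuous g0(1))
  have gc: "g (c x) = x" for x
    using g0(2)[of "c x"] closure_subset[of "range c"] inj by (auto simp: g_def)
  show thesis
  proof (rule that[of r \<Omega> "\<lambda>n w. g (Y' n w)" "\<lambda>w. g (Y w)"])
    show "distr \<Omega> borel (\<lambda>w. g (Y' n w)) = \<mu> (r n)" for n
    proof -
      have "distr \<Omega> borel (\<lambda>w. g (Y' n w)) = distr (distr \<Omega> borel (Y' n)) borel g"
        by (subst distr_distr) (auto simp: comp_def)
      also have "\<dots> = distr (\<mu> (r n)) borel (\<lambda>x. g (c x))"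
        unfolding dY' L_def by (subst distr_distr) (auto simp: comp_def)
      also have "\<dots> = \<mu> (r n)" unfolding gc by (simp add: distr_id2)
      finally show ?thesis .
    qed
    \<comment> \<open>The closure is Borel and contains limits; the range itself is known to have
      neither property.\<close>
    have "AE w in \<Omega>. Y' n w \<in> closure (range c)" for n
    proof -
      have "AE t in distr (\<mu> (r n)) borel c. t \<in> closure (range c)"
        using closure_subset[of "range c"] by (subst AE_distr_iff) auto
      then have "AE t in distr \<Omega> borel (Y' n). t \<in> closure (range c)"
        unfolding dY' L_def .
      then show ?thesis by (subst (asm) AE_distr_iff) auto
    qed
    then have "AE w in \<Omega>. \<forall>n. Y' n w \<in> closure (range c)" by (simp add: AE_all_countable)
    then show "AE w in \<Omega>. (\<lambda>n. g (Y' n w)) \<longlonglongrightarrow> g (Y w)"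
    proof (rule AE_mp, intro AE_I2 impI)
      fix w assume w: "w \<in> space \<Omega>" "\<forall>n. Y' n w \<in> closure (range c)"
      then have "Y w \<in> closure (range c)"
        using closed_sequentially[OF closed_closure _ lim[OF w(1)]] by auto
      moreover from this have "(\<lambda>n. g0 (Y' n w)) \<longlonglongrightarrow> g0 (Y w)"
        using w continuous_on_tendsto_compose[OF uniformly_continuous_imp_continuous[OF g0(1)] lim[OF w(1)]] by auto
      ultimately show "(\<lambda>n. g (Y' n w)) \<longlonglongrightarrow> g (Y w)" using w(2) by (simp add: g_def)
    qed
  qed (use r \<Omega> in auto)
qed


section \<open>The regularized dual problem\<close>

definition exp_sum :: "real \<Rightarrow> 'a::real_inner set \<Rightarrow> ('a \<Rightarrow> real) \<Rightarrow> 'a \<Rightarrow> real" where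
  "exp_sum \<epsilon> V \<phi> y = (\<Sum>v\<in>V. exp ((v \<bullet> y - \<phi> v) / \<epsilon>))"

definition softmax :: "real \<Rightarrow> 'a::real_inner set \<Rightarrow> ('a \<Rightarrow> real) \<Rightarrow> 'a \<Rightarrow> 'a \<Rightarrow> real" where
  "softmax \<epsilon> V \<phi> v y = exp ((v \<bullet> y - \<phi> v) / \<epsilon>) / exp_sum \<epsilon> V \<phi> y"

text \<open>A smooth maximum over v of \<open>v \<bullet> y - \<phi> v\<close>, that is, a
  regularized Legendre transform of \<open>\<phi>\<close> at temperature
  \<open>\<epsilon>\<close>.\<close>

definition log_sum_exp :: "real \<Rightarrow> 'a::real_inner set \<Rightarrow> ('a \<Rightarrow> real) \<Rightarrow> 'a \<Rightarrow> real" where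
  "log_sum_exp \<epsilon> V \<phi> y = \<epsilon> * ln (exp_sum \<epsilon> V \<phi> y)"

lemma exp_sum_pos: "finite V \<Longrightarrow> V \<noteq> {} \<Longrightarrow> 0 < exp_sum \<epsilon> V \<phi> y"
  by (auto simp: exp_sum_def intro!: sum_pos)

lemma exp_sum_eq: "finite V \<Longrightarrow> V \<noteq> {} \<Longrightarrow> 0 < \<epsilon> \<Longrightarrow> exp_sum \<epsilon> V \<phi> y = exp (log_sum_exp \<epsilon> V \<phi> y / \<epsilon>)"
  using exp_sum_pos[of V \<epsilon> \<phi> y] by (simp add: log_sum_exp_def)

lemma softmax_nonneg: "finite V \<Longrightarrow> 0 \<le> softmax \<epsilon> V \<phi> v y"
  by (auto simp: softmax_def exp_sum_def intro!: divide_nonneg_nonneg sum_nonneg)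

lemma softmax_sum: "finite V \<Longrightarrow> V \<noteq> {} \<Longrightarrow> (\<Sum>v\<in>V. softmax \<epsilon> V \<phi> v y) = 1"
  using exp_sum_pos[of V \<epsilon> \<phi> y]
  by (simp add: softmax_def flip: sum_divide_distrib) (simp add: exp_sum_def)

lemma softmax_le_1: "finite V \<Longrightarrow> v \<in> V \<Longrightarrow> softmax \<epsilon> V \<phi> v y \<le> 1"
  using member_le_sum[of v V "\<lambda>v. softmax \<epsilon> V \<phi> v y"] softmax_sum[of V \<epsilon> \<phi> y] softmax_nonneg[of V \<epsilon> \<phi> _ y]
  by fastforce

lemma exp_sum_measurable[measurable]:
  "exp_sum \<epsilon> V \<phi> \<in> borel_measurable (borel :: 'a::euclidean_space measure)"
  unfolding exp_sum_def by measurable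

lemma softmax_measurable[measurable]:
  "softmax \<epsilon> V \<phi> v \<in> borel_measurable (borel :: 'a::euclidean_space measure)"
  unfolding softmax_def by measurable

lemma log_sum_exp_measurable[measurable]:
  "log_sum_exp \<epsilon> V \<phi> \<in> borel_measurable (borel :: 'a::euclidean_space measure)"
  unfolding log_sum_exp_def by measurable

lemma log_sum_exp_ge:
  assumes "finite V" "v \<in> V" "0 < \<epsilon>"
  shows "v \<bullet> y - \<phi> v \<le> log_sum_exp \<epsilon> V \<phi> y"
proof -
  have "exp ((v \<bullet> y - \<phi> v) / \<epsilon>) \<le> exp_sum \<epsilon> V \<phi> y"
    unfolding exp_sum_def using assms member_le_sum[of v V "\<lambda>v. exp ((v \<bullet> y - \<phi> v) / \<epsilon>)"] by simp
  also have "\<dots> = exp (log_sum_exp \<epsilon> V \<phi> y / \<epsilon>)" using assms by (intro exp_sum_eq) auto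
  finally show ?thesis using assms(3) by (simp add: divide_le_cancel)
qed

text \<open>If v falls short of the smooth maximum by \<open>\<epsilon>\<close> * u, its weight is
  exp (- u), and u * exp (- u) is at most 1. So each v costs at most \<open>\<epsilon>\<close> in
  the average.\<close>

lemma log_sum_exp_le_softmax_average:
  assumes V: "finite V" "V \<noteq> {}" and e: "0 < \<epsilon>"
  shows "log_sum_exp \<epsilon> V \<phi> y \<le> (\<Sum>v\<in>V. softmax \<epsilon> V \<phi> v y * (v \<bullet> y - \<phi> v)) + \<epsilon> * card V"
proof -
  let ?L = "log_sum_exp \<epsilon> V \<phi> y"
  have sm: "softmax \<epsilon> V \<phi> v y = exp (- ((?L - (v \<bullet> y - \<phi> v)) / \<epsilon>))" for v
    unfolding softmax_def exp_sum_eq[OF V e] by (simp flip: exp_diff add: diff_divide_distrib)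
  have "exp (- u) * u \<le> 1" for u :: real
  proof -
    have "u \<le> exp u" using exp_ge_add_one_self[of u] by linarith
    then have "exp (- u) * u \<le> exp (- u) * exp u" by (intro mult_left_mono) auto
    also have "\<dots> = 1" by (simp flip: exp_add)
    finally show ?thesis .
  qed
  then have "softmax \<epsilon> V \<phi> v y * ((?L - (v \<bullet> y - \<phi> v)) / \<epsilon>) \<le> 1" for v unfolding sm .
  then have le: "softmax \<epsilon> V \<phi> v y * (?L - (v \<bullet> y - \<phi> v)) \<le> \<epsilon>" for v
    using e by (simp add: field_simps)
  have "?L = (\<Sum>v\<in>V. softmax \<epsilon> V \<phi> v y * ?L)"
    using softmax_sum[OF V] by (simp flip: sum_distrib_right)
  also have "\<dots> = (\<Sum>v\<in>V. softmax \<epsilon> V \<phi> v y * (v \<bullet> y - \<phi> v)) + (\<Sum>v\<in>V. softmax \<epsilon> V \<phi> v y * (?L - (v \<bullet> y - \<phi> v)))"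
    by (simp add: algebra_simps flip: sum.distrib)
  also have "(\<Sum>v\<in>V. softmax \<epsilon> V \<phi> v y * (?L - (v \<bullet> y - \<phi> v))) \<le> (\<Sum>v\<in>V. \<epsilon>)"
    by (intro sum_mono le)
  finally show ?thesis by (simp add: mult.commute)
qed

text \<open>Monotonicity and translation in one statement; \<open>d\<close> may be negative, and
  using it in both directions gives equality for constant shifts.\<close>

lemma log_sum_exp_shift_le:
  assumes V: "finite V" "V \<noteq> {}" and e: "0 < \<epsilon>" and d: "\<And>v. v \<in> V \<Longrightarrow> \<phi> v - d \<le> \<psi> v"
  shows "log_sum_exp \<epsilon> V \<psi> y \<le> log_sum_exp \<epsilon> V \<phi> y + d"
proof -
  have "exp_sum \<epsilon> V \<psi> y \<le> (\<Sum>v\<in>V. exp ((v \<bullet> y - \<phi> v) / \<epsilon>) * exp (d / \<epsilon>))"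
    unfolding exp_sum_def
  proof (rule sum_mono)
    fix v assume "v \<in> V"
    from d[OF this] have "(v \<bullet> y - \<psi> v) / \<epsilon> \<le> (v \<bullet> y - \<phi> v) / \<epsilon> + d / \<epsilon>"
      using e by (simp flip: add_divide_distrib add: divide_right_mono)
    then show "exp ((v \<bullet> y - \<psi> v) / \<epsilon>) \<le> exp ((v \<bullet> y - \<phi> v) / \<epsilon>) * exp (d / \<epsilon>)"
      by (simp flip: exp_add)
  qed
  also have "\<dots> = exp_sum \<epsilon> V \<phi> y * exp (d / \<epsilon>)" by (simp add: exp_sum_def flip: sum_distrib_right)
  finally have "exp (log_sum_exp \<epsilon> V \<psi> y / \<epsilon>) \<le> exp ((log_sum_exp \<epsilon> V \<phi> y + d) / \<epsilon>)"
    using V e by (simp add: exp_sum_eq add_divide_distrib exp_add)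
  then show ?thesis using e by (simp add: divide_le_cancel)
qed

lemma log_sum_exp_shift:
  assumes V: "finite V" "V \<noteq> {}" and e: "0 < \<epsilon>"
  shows "log_sum_exp \<epsilon> V (\<lambda>v. \<phi> v - d) y = log_sum_exp \<epsilon> V \<phi> y + d"
  using log_sum_exp_shift_le[OF V e, of \<phi> d "\<lambda>v. \<phi> v - d" y]
    log_sum_exp_shift_le[OF V e, of "\<lambda>v. \<phi> v - d" "-d" \<phi> y] by simp

text \<open>Linear growth in y provides the integrable majorant.\<close>

lemma log_sum_exp_abs_le:
  assumes V: "finite V" "V \<noteq> {}" and e: "0 < \<epsilon>"
  shows "\<bar>log_sum_exp \<epsilon> V \<phi> y\<bar> \<le> (\<Sum>v\<in>V. \<bar>v \<bullet> y - \<phi> v\<bar>) + \<epsilon> * card V"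
proof -
  obtain w where w: "w \<in> V" using V by auto
  have "\<bar>w \<bullet> y - \<phi> w\<bar> \<le> (\<Sum>v\<in>V. \<bar>v \<bullet> y - \<phi> v\<bar>)"
    using V w by (intro member_le_sum) auto
  moreover have "w \<bullet> y - \<phi> w \<le> log_sum_exp \<epsilon> V \<phi> y" using V w e by (intro log_sum_exp_ge)
  moreover have "(\<Sum>v\<in>V. softmax \<epsilon> V \<phi> v y * (v \<bullet> y - \<phi> v)) \<le> (\<Sum>v\<in>V. \<bar>v \<bullet> y - \<phi> v\<bar>)"
  proof (rule sum_mono)
    fix v assume v: "v \<in> V"
    have "softmax \<epsilon> V \<phi> v y * (v \<bullet> y - \<phi> v) \<le> softmax \<epsilon> V \<phi> v y * \<bar>v \<bullet> y - \<phi> v\<bar>"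
      using softmax_nonneg[OF V(1)] by (intro mult_left_mono) auto
    also have "\<dots> \<le> 1 * \<bar>v \<bullet> y - \<phi> v\<bar>"
      using softmax_le_1[OF V(1) v] by (intro mult_right_mono) auto
    finally show "softmax \<epsilon> V \<phi> v y * (v \<bullet> y - \<phi> v) \<le> \<bar>v \<bullet> y - \<phi> v\<bar>" by simp
  qed
  moreover have "0 \<le> \<epsilon> * card V" using e by simp
  ultimately show ?thesis using log_sum_exp_le_softmax_average[OF V e, of \<phi> y] by linarith
qed

text \<open>This bound makes the first-order condition at a minimizer available without differentiating
  under the integral sign.\<close>

lemma log_sum_exp_coordinate_le:
  assumes V: "finite V" and w: "w \<in> V" and e: "0 < \<epsilon>"
  shows "log_sum_exp \<epsilon> V (\<phi>(w := \<phi> w + t)) y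
    \<le> log_sum_exp \<epsilon> V \<phi> y + \<epsilon> * (exp (- t / \<epsilon>) - 1) * softmax \<epsilon> V \<phi> w y"
proof -
  have ne: "V \<noteq> {}" using w by auto
  define q where "q = softmax \<epsilon> V \<phi> w y"
  define a where "a = exp (- t / \<epsilon>) - 1"
  have Z: "0 < exp_sum \<epsilon> V \<phi> y" by (rule exp_sum_pos[OF V ne])
  \<comment> \<open>Only one summand changes, so the sum is multiplied by 1 + q * a. The claim then
    is ln (1 + u) \<le> u.\<close>
  have "exp_sum \<epsilon> V (\<phi>(w := \<phi> w + t)) y
    = exp ((w \<bullet> y - \<phi> w) / \<epsilon>) * (1 + a) + (\<Sum>v\<in>V - {w}. exp ((v \<bullet> y - \<phi> v) / \<epsilon>))"
  proof -
    have "(w \<bullet> y - (\<phi> w + t)) / \<epsilon> = (w \<bullet> y - \<phi> w) / \<epsilon> + - t / \<epsilon>"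
      by (simp only: add_divide_distrib[symmetric]) simp
    then have "exp ((w \<bullet> y - (\<phi> w + t)) / \<epsilon>) = exp ((w \<bullet> y - \<phi> w) / \<epsilon>) * (1 + a)"
      unfolding a_def by (simp only: exp_add) simp
    then show ?thesis unfolding exp_sum_def using V w by (subst sum.remove[of _ w]) auto
  qed
  also have "\<dots> = exp_sum \<epsilon> V \<phi> y + exp ((w \<bullet> y - \<phi> w) / \<epsilon>) * a"
    unfolding exp_sum_def using V w
    by (subst (2) sum.remove[of _ w]) (simp_all add: distrib_left)
  also have "\<dots> = exp_sum \<epsilon> V \<phi> y * (1 + q * a)"
    using Z by (simp add: q_def softmax_def field_simps)
  finally have Z': "exp_sum \<epsilon> V (\<phi>(w := \<phi> w + t)) y = exp_sum \<epsilon> V \<phi> y * (1 + q * a)" .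
  have "0 < exp_sum \<epsilon> V (\<phi>(w := \<phi> w + t)) y" by (rule exp_sum_pos[OF V ne])
  then have qa: "0 < 1 + q * a" unfolding Z' using Z by (simp add: zero_less_mult_iff)
  have "ln (exp_sum \<epsilon> V (\<phi>(w := \<phi> w + t)) y) = ln (exp_sum \<epsilon> V \<phi> y) + ln (1 + q * a)"
    unfolding Z' using Z qa by (simp add: ln_mult)
  also have "ln (1 + q * a) \<le> q * a" using ln_le_minus_one[OF qa] by simp
  finally have "\<epsilon> * ln (exp_sum \<epsilon> V (\<phi>(w := \<phi> w + t)) y) \<le> \<epsilon> * (ln (exp_sum \<epsilon> V \<phi> y) + q * a)"
    using e by (simp add: mult_left_mono)
  then show ?thesis unfolding log_sum_exp_def q_def[symmetric] a_def[symmetric]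
    by (simp add: algebra_simps)
qed

lemma log_sum_exp_integrable:
  fixes \<nu> :: "'a::euclidean_space measure"
  assumes V: "finite V" "V \<noteq> {}" and e: "0 < \<epsilon>" and "prob_space \<nu>"
    and s[measurable_cong]: "sets \<nu> = sets borel" and i: "integrable \<nu> (\<lambda>y. y)"
  shows "integrable \<nu> (log_sum_exp \<epsilon> V \<phi>)"
proof -
  interpret prob_space \<nu> by fact
  show ?thesis
  proof (rule Bochner_Integration.integrable_bound)
    show "integrable \<nu> (\<lambda>y. (\<Sum>v\<in>V. \<bar>v \<bullet> y - \<phi> v\<bar>) + \<epsilon> * card V)"
      using i by (intro Bochner_Integration.integrable_add integrable_sum integrable_abs Bochner_Integration.integrable_diff integrable_inner_right) auto
    show "AE y in \<nu>. norm (log_sum_exp \<epsilon> V \<phi> y) \<le> norm ((\<Sum>v\<in>V. \<bar>v \<bullet> y - \<phi> v\<bar>) + \<epsilon> * card V)"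
      using log_sum_exp_abs_le[OF V e] by (auto intro: order_trans[OF _ abs_ge_self])
  qed measurable
qed

text \<open>A minimizer of the dual functional \<open>F\<close> works, since the partial derivative
  of \<open>F\<close> at w is p w minus the integral of the softmax weight. \<open>F\<close> is
  invariant under constant shifts, so coercivity holds only after the minimum of the potential is
  normalized to 0.\<close>

lemma softmax_potential_exists:
  fixes \<nu> :: "'a::euclidean_space measure" and V :: "'a set"
  assumes V: "finite V" "V \<noteq> {}" and e: "0 < \<epsilon>" and prob: "prob_space \<nu>"
    and s[measurable_cong]: "sets \<nu> = sets borel" and i: "integrable \<nu> (\<lambda>y. y)"
    and p: "\<And>v. v \<in> V \<Longrightarrow> 0 < p v" "(\<Sum>v\<in>V. p v) = 1"
  shows "\<exists>\<phi>. \<forall>v\<in>V. (\<integral>y. softmax \<epsilon> V \<phi> v y \<partial>\<nu>) = p v"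
proof -
  interpret prob_space \<nu> by fact
  note Li = log_sum_exp_integrable[OF V e prob s i]
  define F where "F \<phi> = (\<Sum>v\<in>V. p v * \<phi> v) + (\<integral>y. log_sum_exp \<epsilon> V \<phi> y \<partial>\<nu>)" for \<phi>
  have shift: "F (\<lambda>v. \<phi> v - d) = F \<phi>" for \<phi> d
  proof -
    have "(\<Sum>v\<in>V. p v * (\<phi> v - d)) = (\<Sum>v\<in>V. p v * \<phi> v) - d"
      using p(2) by (simp add: right_diff_distrib sum_subtractf flip: sum_distrib_right)
    then show ?thesis
      unfolding F_def log_sum_exp_shift[OF V e] using Li[of \<phi>] by (simp add: prob_space)
  qed
  \<comment> \<open>In the coefficient p v + 1 the first term comes from the linear part and the 1
    from shifting the log-sum-exp. The estimate gives continuity and also shows that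
    \<open>F\<close> only sees values on \<open>V\<close>.\<close>
  have Fdiff: "F \<psi> \<le> F \<phi> + (\<Sum>v\<in>V. (p v + 1) * \<bar>\<psi> v - \<phi> v\<bar>)" for \<phi> \<psi>
  proof -
    define d where "d = (\<Sum>v\<in>V. \<bar>\<psi> v - \<phi> v\<bar>)"
    have "\<phi> v - d \<le> \<psi> v" if "v \<in> V" for v
      using member_le_sum[of v V "\<lambda>v. \<bar>\<psi> v - \<phi> v\<bar>"] V that unfolding d_def by simp
    then have "(\<integral>y. log_sum_exp \<epsilon> V \<psi> y \<partial>\<nu>) \<le> (\<integral>y. log_sum_exp \<epsilon> V \<phi> y + d \<partial>\<nu>)"
      using Li by (intro integral_mono log_sum_exp_shift_le[OF V e]) auto
    also have "\<dots> = (\<integral>y. log_sum_exp \<epsilon> V \<phi> y \<partial>\<nu>) + d" using Li by (simp add: prob_space)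
    moreover have "(\<Sum>v\<in>V. p v * \<psi> v) \<le> (\<Sum>v\<in>V. p v * \<phi> v + p v * \<bar>\<psi> v - \<phi> v\<bar>)"
    proof (rule sum_mono)
      fix v assume v: "v \<in> V"
      have "p v * \<psi> v \<le> p v * (\<phi> v + \<bar>\<psi> v - \<phi> v\<bar>)"
        using p(1)[OF v] by (intro mult_left_mono) auto
      then show "p v * \<psi> v \<le> p v * \<phi> v + p v * \<bar>\<psi> v - \<phi> v\<bar>" by (simp add: distrib_left)
    qed
    ultimately show ?thesis unfolding F_def d_def by (simp add: sum.distrib distrib_right)
  qed
  have cont: "continuous_on UNIV F"
    unfolding continuous_on_def
  proof
    fix \<phi> :: "'a \<Rightarrow> real"
    have c: "((\<lambda>\<psi>. \<psi> v) \<longlongrightarrow> \<phi> v) (at \<phi>)" for v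
      using continuous_on_product_coordinates[of v] unfolding continuous_on_def by auto
    let ?d = "\<lambda>\<psi>. \<Sum>v\<in>V. (p v + 1) * \<bar>\<psi> v - \<phi> v\<bar>"
    have "(?d \<longlongrightarrow> (\<Sum>v\<in>V. (p v + 1) * \<bar>\<phi> v - \<phi> v\<bar>)) (at \<phi>)"
      by (intro tendsto_intros c)
    then have d0: "(?d \<longlongrightarrow> 0) (at \<phi>)" by simp
    have bd: "norm (F \<psi> - F \<phi>) \<le> ?d \<psi>" for \<psi>
      using Fdiff[of \<psi> \<phi>] Fdiff[of \<phi> \<psi>] by (simp add: abs_minus_commute abs_le_iff)
    have "((\<lambda>\<psi>. F \<psi> - F \<phi>) \<longlongrightarrow> 0) (at \<phi>)"
      by (rule Lim_null_comparison[OF always_eventually d0]) (use bd in blast)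
    then show "(F \<longlongrightarrow> F \<phi>) (at \<phi>)" by (simp add: LIM_zero_iff)
  qed
  define m where "m = Min (p ` V)"
  have m: "0 < m" "\<And>v. v \<in> V \<Longrightarrow> m \<le> p v" unfolding m_def using V p(1) by auto
  define J where "J = (\<Sum>v\<in>V. \<bar>\<integral>y. v \<bullet> y \<partial>\<nu>\<bar>)"
  have J: "- J \<le> (\<integral>y. v \<bullet> y \<partial>\<nu>)" if "v \<in> V" for v
    using member_le_sum[of v V "\<lambda>v. \<bar>\<integral>y. v \<bullet> y \<partial>\<nu>\<bar>"] V that unfolding J_def by simp
  \<comment> \<open>Chosen so that m * B is at least F 0 + J: a normalized potential with a
    coordinate above \<open>B\<close> cannot beat the zero potential.\<close>
  define B where "B = max 0 ((F (\<lambda>_. 0) + J) / m)"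
  \<comment> \<open>Potentials are functions on the whole space, so the box is an infinite product,
    compact by Tychonoff; the coordinates off \<open>V\<close> do not affect
    \<open>F\<close>.\<close>
  define K where "K = (\<Pi>\<^sub>E v\<in>(UNIV::'a set). {0..B} :: real set)"
  have "compact K"
  proof -
    have "compactin (product_topology (\<lambda>_::'a. euclidean) UNIV) K"
      unfolding K_def by (simp add: compactin_PiE)
    then show ?thesis unfolding euclidean_product_topology by simp
  qed
  moreover have zero: "(\<lambda>_. 0) \<in> K" unfolding K_def B_def by auto
  ultimately obtain \<phi> where \<phi>: "\<phi> \<in> K" "\<And>\<psi>. \<psi> \<in> K \<Longrightarrow> F \<phi> \<le> F \<psi>"
    using continuous_attains_inf[of K F] continuous_on_subset[OF cont] by blast
  have Fcong: "F \<phi> = F \<psi>" if "\<And>v. v \<in> V \<Longrightarrow> \<phi> v = \<psi> v" for \<phi> \<psi>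
    using Fdiff[of \<phi> \<psi>] Fdiff[of \<psi> \<phi>] that by simp
  have min: "F \<phi> \<le> F \<psi>" for \<psi>
  proof -
    \<comment> \<open>Subtracting the minimum keeps \<open>F\<close>, makes the potential
      nonnegative and makes it vanish at some \<open>u\<close> in \<open>V\<close>. Off
      \<open>V\<close> it is set to 0 to fit the box.\<close>
    define c where "c = Min (\<psi> ` V)"
    obtain u where u: "u \<in> V" "\<psi> u = c" unfolding c_def using V Min_in[of "\<psi> ` V"] by fastforce
    define \<theta> where "\<theta> v = (if v \<in> V then \<psi> v - c else 0)" for v
    have nn: "0 \<le> \<theta> v" for v unfolding \<theta>_def c_def using V by auto
    have F\<theta>: "F \<theta> = F \<psi>"
      using shift[of \<psi> c] Fcong[of \<theta> "\<lambda>v. \<psi> v - c"] by (simp add: \<theta>_def)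
    show ?thesis
    proof (cases "\<theta> \<in> K")
      case True
      then show ?thesis using \<phi>(2) F\<theta> by fastforce
    next
      case False
      then obtain w where w: "B < \<theta> w" unfolding K_def using nn by (auto simp: PiE_iff not_le)
      then have wV: "w \<in> V" unfolding \<theta>_def B_def by (auto split: if_splits)
      \<comment> \<open>The coordinate \<open>w\<close> alone makes the linear part at least F 0 +
        J, while the integral part is at least -J because the log-sum-exp dominates
        \<open>u \<bullet> y\<close>.\<close>
      have "F (\<lambda>_. 0) + J \<le> m * B"
        unfolding B_def using m(1) by (auto simp: max_def field_simps)
      also have "\<dots> \<le> m * \<theta> w" using w m(1) by simp
      also have "\<dots> \<le> p w * \<theta> w" using m(2)[OF wV] nn by (intro mult_right_mono)
      also have "\<dots> \<le> (\<Sum>v\<in>V. p v * \<theta> v)"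
        using V wV nn p(1) by (intro member_le_sum) (auto intro: mult_nonneg_nonneg less_imp_le)
      also have "- J \<le> (\<integral>y. u \<bullet> y \<partial>\<nu>)" by (rule J[OF u(1)])
      then have "- J \<le> (\<integral>y. log_sum_exp \<epsilon> V \<theta> y \<partial>\<nu>)"
      proof (rule order_trans, intro integral_mono Li)
        show "integrable \<nu> (\<lambda>y. u \<bullet> y)" using i by simp
        show "u \<bullet> y \<le> log_sum_exp \<epsilon> V \<theta> y" for y
          using log_sum_exp_ge[OF V(1) u(1) e, of y \<theta>] u by (simp add: \<theta>_def)
      qed
      ultimately have "F (\<lambda>_. 0) \<le> F \<theta>" unfolding F_def[of \<theta>] by linarith
      then show ?thesis using \<phi>(2)[OF zero] F\<theta> by simp
    qed
  qed
  have "(\<integral>y. softmax \<epsilon> V \<phi> w y \<partial>\<nu>) = p w" if w: "w \<in> V" for w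
  proof -
    define q where "q = (\<integral>y. softmax \<epsilon> V \<phi> w y \<partial>\<nu>)"
    \<comment> \<open>F \<phi> + k t lies above \<open>F\<close> along the coordinate
      \<open>w\<close> and touches it at t = 0. Minimality makes \<open>k\<close> nonnegative with k
      0 = 0, so its derivative p w - q vanishes there.\<close>
    define k where "k t = p w * t + \<epsilon> * (exp (- t / \<epsilon>) - 1) * q" for t
    have si: "integrable \<nu> (softmax \<epsilon> V \<phi> w)"
      using softmax_nonneg[OF V(1)] softmax_le_1[OF V(1) w]
      by (intro integrable_const_bound[where B=1]) auto
    have "0 \<le> k t" for t
    proof -
      have "(\<integral>y. log_sum_exp \<epsilon> V (\<phi>(w := \<phi> w + t)) y \<partial>\<nu>) \<le>
        (\<integral>y. log_sum_exp \<epsilon> V \<phi> y + \<epsilon> * (exp (- t / \<epsilon>) - 1) * softmax \<epsilon> V \<phi> w y \<partial>\<nu>)"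
        using Li si by (intro integral_mono log_sum_exp_coordinate_le V w e) auto
      also have "\<dots> = (\<integral>y. log_sum_exp \<epsilon> V \<phi> y \<partial>\<nu>) + \<epsilon> * (exp (- t / \<epsilon>) - 1) * q"
        using Li si by (simp add: q_def)
      moreover have "(\<Sum>v\<in>V. p v * (\<phi>(w := \<phi> w + t)) v) = (\<Sum>v\<in>V. p v * \<phi> v) + p w * t"
        using V w by (simp add: sum.remove[of V w] algebra_simps)
      ultimately have "F (\<phi>(w := \<phi> w + t)) \<le> F \<phi> + k t" unfolding F_def k_def by linarith
      then show ?thesis using min[of "\<phi>(w := \<phi> w + t)"] by linarith
    qed
    moreover have "k 0 = 0" by (simp add: k_def)
    moreover have "(k has_real_derivative (p w - q)) (at 0)"
      unfolding k_def using e by (auto intro!: derivative_eq_intros)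
    ultimately have "p w - q = 0"
      by (intro DERIV_local_min[of k _ 0 1]) auto
    then show ?thesis by (simp add: q_def)
  qed
  then show ?thesis by blast
qed


section \<open>Couplings\<close>

lemma
  fixes u :: "'m \<Rightarrow> real" and k :: "'n \<Rightarrow> real"
  assumes "prob_space M" "prob_space N" and u: "integrable M u" and k: "integrable N k"
  shows integrable_pair_mult: "integrable (M \<Otimes>\<^sub>M N) (\<lambda>z. u (fst z) * k (snd z))"
    and integral_pair_mult: "(\<integral>z. u (fst z) * k (snd z) \<partial>(M \<Otimes>\<^sub>M N)) = (\<integral>x. u x \<partial>M) * (\<integral>y. k y \<partial>N)"
proof -
  interpret M: prob_space M by fact
  interpret N: prob_space N by fact
  interpret P: pair_sigma_finite M N ..
  have [measurable]: "u \<in> borel_measurable M" "k \<in> borel_measurable N" using u k by auto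
  show i: "integrable (M \<Otimes>\<^sub>M N) (\<lambda>z. u (fst z) * k (snd z))"
    by (rule P.Fubini_integrable) (use u k in \<open>auto simp: abs_mult\<close>)
  show "(\<integral>z. u (fst z) * k (snd z) \<partial>(M \<Otimes>\<^sub>M N)) = (\<integral>x. u x \<partial>M) * (\<integral>y. k y \<partial>N)"
    using P.integral_fst'[OF i] by simp
qed

text \<open>Tonelli in either order. The factors are general probability spaces because in the
  triangle inequality they are couplings themselves.\<close>

lemma density_coupling:
  fixes M :: "'m measure" and N :: "'n measure" and h :: "'m \<times> 'n \<Rightarrow> ennreal"
  assumes "prob_space M" "prob_space N" and [measurable]: "h \<in> borel_measurable (M \<Otimes>\<^sub>M N)"
    and 1: "AE x in M. (\<integral>\<^sup>+y. h (x, y) \<partial>N) = 1" and 2: "AE y in N. (\<integral>\<^sup>+x. h (x, y) \<partial>M) = 1"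
  shows "prob_space (density (M \<Otimes>\<^sub>M N) h)"
    "distr (density (M \<Otimes>\<^sub>M N) h) M fst = M" "distr (density (M \<Otimes>\<^sub>M N) h) N snd = N"
proof -
  interpret M: prob_space M by fact
  interpret N: prob_space N by fact
  interpret P: pair_sigma_finite M N ..
  show f: "distr (density (M \<Otimes>\<^sub>M N) h) M fst = M"
  proof (rule measure_eqI)
    fix A assume "A \<in> sets (distr (density (M \<Otimes>\<^sub>M N) h) M fst)"
    then have A[measurable]: "A \<in> sets M" by simp
    have "emeasure (distr (density (M \<Otimes>\<^sub>M N) h) M fst) A
      = (\<integral>\<^sup>+z. h z * indicator (fst -` A \<inter> space (M \<Otimes>\<^sub>M N)) z \<partial>(M \<Otimes>\<^sub>M N))"
      by (subst emeasure_distr, simp, simp, subst emeasure_density) auto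
    also have "\<dots> = (\<integral>\<^sup>+z. h z * indicator A (fst z) \<partial>(M \<Otimes>\<^sub>M N))"
      by (intro nn_integral_cong) (auto split: split_indicator)
    also have "\<dots> = (\<integral>\<^sup>+x. \<integral>\<^sup>+y. h (x, y) * indicator A x \<partial>N \<partial>M)"
      by (subst N.nn_integral_fst[symmetric]) auto
    also have "\<dots> = (\<integral>\<^sup>+x. (\<integral>\<^sup>+y. h (x, y) \<partial>N) * indicator A x \<partial>M)"
      by (intro nn_integral_cong nn_integral_multc) auto
    also have "\<dots> = (\<integral>\<^sup>+x. indicator A x \<partial>M)"
      by (rule nn_integral_cong_AE) (use 1 in \<open>auto elim: eventually_mono\<close>)
    finally show "emeasure (distr (density (M \<Otimes>\<^sub>M N) h) M fst) A = emeasure M A" by simp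
  qed simp
  show "distr (density (M \<Otimes>\<^sub>M N) h) N snd = N"
  proof (rule measure_eqI)
    fix A assume "A \<in> sets (distr (density (M \<Otimes>\<^sub>M N) h) N snd)"
    then have A[measurable]: "A \<in> sets N" by simp
    have "emeasure (distr (density (M \<Otimes>\<^sub>M N) h) N snd) A
      = (\<integral>\<^sup>+z. h z * indicator (snd -` A \<inter> space (M \<Otimes>\<^sub>M N)) z \<partial>(M \<Otimes>\<^sub>M N))"
      by (subst emeasure_distr, simp, simp, subst emeasure_density) auto
    also have "\<dots> = (\<integral>\<^sup>+z. h z * indicator A (snd z) \<partial>(M \<Otimes>\<^sub>M N))"
      by (intro nn_integral_cong) (auto split: split_indicator)
    also have "\<dots> = (\<integral>\<^sup>+y. \<integral>\<^sup>+x. h (x, y) * indicator A y \<partial>M \<partial>N)"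
      by (subst P.nn_integral_snd[symmetric]) auto
    also have "\<dots> = (\<integral>\<^sup>+y. (\<integral>\<^sup>+x. h (x, y) \<partial>M) * indicator A y \<partial>N)"
      by (intro nn_integral_cong nn_integral_multc) auto
    also have "\<dots> = (\<integral>\<^sup>+y. indicator A y \<partial>N)"
      by (rule nn_integral_cong_AE) (use 2 in \<open>auto elim: eventually_mono\<close>)
    finally show "emeasure (distr (density (M \<Otimes>\<^sub>M N) h) N snd) A = emeasure N A" by simp
  qed simp
  have "prob_space (distr (density (M \<Otimes>\<^sub>M N) h) M fst)" unfolding f by fact
  then show "prob_space (density (M \<Otimes>\<^sub>M N) h)" by (rule prob_space_distrD[rotated]) simp
qed

text \<open>Density of a mixture: choose v with probability p v, then independently draw from the
  first law conditioned on \<open>C v\<close> and from the second law reweighted by g v / p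
  v.\<close>

definition block_weight :: "'v set \<Rightarrow> ('v \<Rightarrow> 'm set) \<Rightarrow> ('v \<Rightarrow> 'n \<Rightarrow> real) \<Rightarrow> ('v \<Rightarrow> real) \<Rightarrow> 'm \<times> 'n \<Rightarrow> real" where
  "block_weight V C g p z = (\<Sum>v\<in>V. indicator (C v) (fst z) * (g v (snd z) / p v))"

lemma block_weight_measurable[measurable]:
  assumes [measurable]: "\<And>v. C v \<in> sets M" "\<And>v. g v \<in> borel_measurable N"
  shows "block_weight V C g p \<in> borel_measurable (M \<Otimes>\<^sub>M N)"
  unfolding block_weight_def by measurable

text \<open>The functions \<open>g v\<close> are fractional memberships: softmax weights in the
  construction from convex order, indicators of level sets in the gluing of two plans. The marginals
  are right because block v has the same mass p v on both sides.\<close>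

lemma block_coupling:
  fixes M :: "'m measure" and N :: "'n measure"
  assumes "prob_space M" "prob_space N" and V: "finite V"
    and C[measurable]: "\<And>v. C v \<in> sets M" and disj: "disjoint_family_on C V"
    and cover: "AE x in M. x \<in> (\<Union>v\<in>V. C v)"
    and g[measurable]: "\<And>v. g v \<in> borel_measurable N" and g0: "\<And>v y. 0 \<le> g v y"
    and g1: "AE y in N. (\<Sum>v\<in>V. g v y) = 1"
    and p: "\<And>v. v \<in> V \<Longrightarrow> 0 < p v" "\<And>v. v \<in> V \<Longrightarrow> measure M (C v) = p v"
      "\<And>v. v \<in> V \<Longrightarrow> (\<integral>y. g v y \<partial>N) = p v"
  defines "\<gamma> \<equiv> density (M \<Otimes>\<^sub>M N) (\<lambda>z. ennreal (block_weight V C g p z))"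
  shows "prob_space \<gamma> \<and> distr \<gamma> M fst = M \<and> distr \<gamma> N snd = N"
proof -
  interpret M: prob_space M by fact
  interpret N: prob_space N by fact
  have nn: "0 \<le> block_weight V C g p z" for z
    unfolding block_weight_def using g0 p(1) by (intro sum_nonneg mult_nonneg_nonneg) (auto simp: less_imp_le)
  have gi: "integrable N (g v)" if "v \<in> V" for v
  proof (rule N.integrable_const_bound[where B=1])
    show "AE y in N. norm (g v y) \<le> 1"
      using g1
    proof eventually_elim
      case (elim y)
      then show ?case using member_le_sum[of v V "\<lambda>v. g v y"] V that g0 by simp
    qed
  qed simp
  have 1: "AE x in M. (\<integral>\<^sup>+y. ennreal (block_weight V C g p (x, y)) \<partial>N) = 1"
    using cover AE_space
  proof eventually_elim
    case (elim x)
    have i: "integrable N (\<lambda>y. block_weight V C g p (x, y))"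
      unfolding block_weight_def using gi by (auto intro!: Bochner_Integration.integrable_sum)
    have "(\<integral>y. block_weight V C g p (x, y) \<partial>N) = (\<Sum>v\<in>V. indicator (C v) x * ((\<integral>y. g v y \<partial>N) / p v))"
      unfolding block_weight_def using gi by (subst Bochner_Integration.integral_sum) auto
    also have "\<dots> = (\<Sum>v\<in>V. indicator (C v) x)"
      using p by (intro sum.cong) (auto simp: less_imp_neq[symmetric])
    also have "\<dots> = indicator (\<Union>v\<in>V. C v) x"
      by (rule indicator_UN_disjoint[OF V disj, symmetric])
    finally show ?case
      using nn_integral_eq_integral[OF i] nn elim by simp
  qed
  have 2: "AE y in N. (\<integral>\<^sup>+x. ennreal (block_weight V C g p (x, y)) \<partial>M) = 1"
    using g1
  proof eventually_elim
    case (elim y)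
    have ind: "integrable M (indicat_real (C v))" for v
      by (intro integrable_real_indicator C) (simp add: less_top[symmetric])
    then have i: "integrable M (\<lambda>x. block_weight V C g p (x, y))"
      unfolding block_weight_def by (auto intro!: Bochner_Integration.integrable_sum)
    have "(\<integral>x. block_weight V C g p (x, y) \<partial>M) = (\<Sum>v\<in>V. measure M (C v) * (g v y / p v))"
      unfolding block_weight_def using ind by (subst Bochner_Integration.integral_sum) auto
    also have "\<dots> = (\<Sum>v\<in>V. g v y)"
      using p by (intro sum.cong) (auto simp: less_imp_neq[symmetric])
    finally show ?case
      using nn_integral_eq_integral[OF i] nn elim by simp
  qed
  have h: "(\<lambda>z. ennreal (block_weight V C g p z)) \<in> borel_measurable (M \<Otimes>\<^sub>M N)" by measurable
  show ?thesis
    using density_coupling[OF assms(1,2) h 1 2] unfolding \<gamma>_def by blast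
qed

section \<open>Finitely valued approximation in quadratic mean\<close>

lemma simple_approx_L2:
  fixes \<mu> :: "'a::euclidean_space measure"
  assumes \<mu>: "\<mu> \<in> P2" and e: "0 < \<eta>"
  shows "\<exists>s. s \<in> borel_measurable borel \<and> finite (range s) \<and> integrable \<mu> (\<lambda>x. (norm (s x))\<^sup>2)
    \<and> sqrt (\<integral>x. (norm (x - s x))\<^sup>2 \<partial>\<mu>) \<le> \<eta>"
proof -
  have S[measurable_cong]: "sets \<mu> = sets borel" and "prob_space \<mu>"
    and i: "integrable \<mu> (\<lambda>x. (norm x)\<^sup>2)"
    using \<mu> by (auto simp: P2_iff)
  interpret prob_space \<mu> by fact
  obtain F :: "nat \<Rightarrow> 'a \<Rightarrow> 'a" where F: "\<And>n. simple_function borel (F n)"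
    "\<And>x. (\<lambda>n. F n x) \<longlonglongrightarrow> x" "\<And>n x. dist (F n x) 0 \<le> 2 * dist x 0"
    using borel_measurable_implies_sequence_metric[of "\<lambda>x::'a. x" borel 0] by auto
  have Fm[measurable]: "F n \<in> borel_measurable borel" for n
    using F(1) by (rule borel_measurable_simple_function)
  have Fr: "finite (range (F n))" for n using F(1)[of n] by (simp add: simple_function_def)
  have Fi: "integrable \<mu> (\<lambda>x. (norm (F n x))\<^sup>2)" for n
  proof (rule Bochner_Integration.integrable_bound)
    show "integrable \<mu> (\<lambda>x. 4 * (norm x)\<^sup>2)" using i by simp
    have "(norm (F n x))\<^sup>2 \<le> (2 * norm x)\<^sup>2" for x
      using F(3)[of n x] by (intro power_mono) auto
    then show "AE x in \<mu>. norm ((norm (F n x))\<^sup>2) \<le> norm (4 * (norm x)\<^sup>2)"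
      by (auto simp: power_mult_distrib)
  qed simp
  have "(\<lambda>n. \<integral>x. (norm (x - F n x))\<^sup>2 \<partial>\<mu>) \<longlonglongrightarrow> (\<integral>x. 0 \<partial>\<mu>)"
  \<comment> \<open>The approximants satisfy |F n x| \<le> 2 |x|, so the error is at most 3 |x|,
    whence the factor 9.\<close>
  proof (rule integral_dominated_convergence[where w="\<lambda>x. 9 * (norm x)\<^sup>2"])
    show "AE x in \<mu>. (\<lambda>n. (norm (x - F n x))\<^sup>2) \<longlonglongrightarrow> 0"
    proof (rule AE_I2)
      fix x
      have "(\<lambda>n. (norm (x - F n x))\<^sup>2) \<longlonglongrightarrow> (norm (x - x))\<^sup>2"
        by (intro tendsto_intros F)
      then show "(\<lambda>n. (norm (x - F n x))\<^sup>2) \<longlonglongrightarrow> 0" by simp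
    qed
    fix n
    have "norm (x - F n x) \<le> 3 * norm x" for x
      using norm_triangle_ineq4[of x "F n x"] F(3)[of n x] by simp
    then have "(norm (x - F n x))\<^sup>2 \<le> (3 * norm x)\<^sup>2" for x
      by (intro power_mono) auto
    then show "AE x in \<mu>. norm ((norm (x - F n x))\<^sup>2) \<le> 9 * (norm x)\<^sup>2"
      by (auto simp: power_mult_distrib)
  qed (use i in auto)
  then have "eventually (\<lambda>n. (\<integral>x. (norm (x - F n x))\<^sup>2 \<partial>\<mu>) < \<eta>\<^sup>2) sequentially"
    using order_tendstoD(2)[of _ _ _ "\<eta>\<^sup>2"] e by force
  then obtain n where "(\<integral>x. (norm (x - F n x))\<^sup>2 \<partial>\<mu>) < \<eta>\<^sup>2"
    by (auto simp: eventually_sequentially)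
  then have "sqrt (\<integral>x. (norm (x - F n x))\<^sup>2 \<partial>\<mu>) \<le> \<eta>"
    using e by (intro real_le_lsqrt) auto
  then show ?thesis using Fr Fi Fm by blast
qed

text \<open>Values of mass zero are discarded because block weights divide by the mass; almost
  surely nothing is lost.\<close>

lemma charged_values:
  fixes \<mu> :: "'a::euclidean_space measure" and s :: "'a \<Rightarrow> 'a"
  assumes "prob_space \<mu>" and S[measurable_cong]: "sets \<mu> = sets borel"
    and s[measurable]: "s \<in> borel_measurable borel" and fin: "finite (range s)"
  defines "V \<equiv> {v. 0 < measure \<mu> (s -` {v})}"
  shows "finite V" "V \<noteq> {}" "AE x in \<mu>. s x \<in> V" "(\<Sum>v\<in>V. measure \<mu> (s -` {v})) = 1"
proof -
  interpret prob_space \<mu> by fact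
  have sp[simp]: "space \<mu> = UNIV" using sets_eq_imp_space_eq[OF S] by simp
  have C[measurable]: "s -` {v} \<in> sets \<mu>" for v
    using measurable_sets_borel[OF s, of "{v}"] S by simp
  have "V \<subseteq> range s"
  proof
    fix v assume "v \<in> V"
    then have "s -` {v} \<noteq> {}" unfolding V_def by auto
    then show "v \<in> range s" by auto
  qed
  then show finV: "finite V" using fin finite_subset by blast
  have "AE x in \<mu>. s x \<noteq> v" if "v \<notin> V" for v
  proof -
    have "measure \<mu> (s -` {v}) = 0" using that measure_nonneg[of \<mu> "s -` {v}"] unfolding V_def by simp
    then have "emeasure \<mu> (s -` {v}) = 0" by (simp add: emeasure_eq_measure)
    then show ?thesis by (intro AE_I[OF _ _ C]) auto
  qed
  then have "AE x in \<mu>. \<forall>v\<in>range s - V. s x \<noteq> v"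
    using fin by (subst AE_finite_all) auto
  then show AEV: "AE x in \<mu>. s x \<in> V" by eventually_elim auto
  have "(\<Sum>v\<in>V. measure \<mu> (s -` {v})) = (\<integral>x. (\<Sum>v\<in>V. indicator (s -` {v}) x) \<partial>\<mu>)"
    by (subst Bochner_Integration.integral_sum) (auto intro!: integrable_real_indicator C simp: less_top[symmetric])
  also have "\<dots> = (\<integral>x. 1 \<partial>\<mu>)"
  proof (rule integral_cong_AE)
    show "AE x in \<mu>. (\<Sum>v\<in>V. indicator (s -` {v}) x) = (1::real)"
      using AEV
    proof eventually_elim
      case (elim x)
      have "(\<Sum>v\<in>V. indicator (s -` {v}) x) = (\<Sum>v\<in>V. if s x = v then 1 else (0::real))"
        by (intro sum.cong) (auto simp: indicator_def)
      then show ?case using finV elim by simp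
    qed
  qed auto
  finally show "(\<Sum>v\<in>V. measure \<mu> (s -` {v})) = 1" by (simp add: prob_space[simplified])
  then show "V \<noteq> {}" by auto
qed

section \<open>Near-optimal couplings and the triangle inequality for \<open>W2\<close>\<close>

lemma couplingsD:
  assumes "\<pi> \<in> couplings \<mu> \<nu>"
  shows "prob_space \<pi>" "sets \<pi> = sets (borel \<Otimes>\<^sub>M borel)" "distr \<pi> borel fst = \<mu>" "distr \<pi> borel snd = \<nu>"
  using assms by (auto simp: couplings_def)

lemma coupling_second_moments:
  fixes \<mu> \<nu> :: "'a::euclidean_space measure"
  assumes \<pi>: "\<pi> \<in> couplings \<mu> \<nu>" and P: "\<mu> \<in> P2" "\<nu> \<in> P2"
  shows "integrable \<pi> (\<lambda>z. (norm (fst z))\<^sup>2)" "integrable \<pi> (\<lambda>z. (norm (snd z))\<^sup>2)"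
    "integrable \<pi> (\<lambda>z. (norm (fst z - snd z))\<^sup>2)"
proof -
  note c = couplingsD[OF \<pi>]
  note [measurable_cong] = c(2)
  show "integrable \<pi> (\<lambda>z. (norm (fst z))\<^sup>2)"
    using P(1) integrable_distr_eq[of fst \<pi> borel "\<lambda>x. (norm x)\<^sup>2"] unfolding c by (simp add: P2_iff)
  moreover show "integrable \<pi> (\<lambda>z. (norm (snd z))\<^sup>2)"
    using P(2) integrable_distr_eq[of snd \<pi> borel "\<lambda>x. (norm x)\<^sup>2"] unfolding c by (simp add: P2_iff)
  ultimately show "integrable \<pi> (\<lambda>z. (norm (fst z - snd z))\<^sup>2)"
    by (intro integrable_norm_sq_diff) auto
qed

lemma W2_le:
  assumes "\<pi> \<in> couplings \<mu> \<nu>"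
  shows "W2 \<mu> \<nu> \<le> sqrt (\<integral>z. (norm (fst z - snd z))\<^sup>2 \<partial>\<pi>)"
  unfolding W2_def
  by (intro real_sqrt_le_mono cINF_lower[OF _ assms] bdd_belowI2[where m=0]) simp

text \<open>Keeps the infimum in \<open>W2\<close> from ranging over an empty set.\<close>

lemma product_in_couplings:
  fixes \<mu> \<nu> :: "'a::euclidean_space measure"
  assumes "prob_space \<mu>" "prob_space \<nu>" "sets \<mu> = sets borel" "sets \<nu> = sets borel"
  shows "\<mu> \<Otimes>\<^sub>M \<nu> \<in> couplings \<mu> \<nu>"
proof -
  interpret \<mu>: prob_space \<mu> by fact
  interpret \<nu>: prob_space \<nu> by fact
  interpret P: pair_prob_space \<mu> \<nu> ..
  have d: "density (\<mu> \<Otimes>\<^sub>M \<nu>) (\<lambda>_. 1) = \<mu> \<Otimes>\<^sub>M \<nu>" by (rule density_1)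
  have "distr (\<mu> \<Otimes>\<^sub>M \<nu>) \<mu> fst = \<mu>" "distr (\<mu> \<Otimes>\<^sub>M \<nu>) \<nu> snd = \<nu>"
    using density_coupling[OF assms(1,2), of "\<lambda>_. 1"] by (simp_all add: d \<mu>.emeasure_space_1 \<nu>.emeasure_space_1)
  moreover have "distr (\<mu> \<Otimes>\<^sub>M \<nu>) \<mu> fst = distr (\<mu> \<Otimes>\<^sub>M \<nu>) borel fst" "distr (\<mu> \<Otimes>\<^sub>M \<nu>) \<nu> snd = distr (\<mu> \<Otimes>\<^sub>M \<nu>) borel snd"
    using assms by (auto intro!: distr_cong)
  ultimately show ?thesis
    unfolding couplings_def using assms P.prob_space_axioms sets_pair_measure_cong[OF assms(3,4)] by simp
qed

lemma W2_nonneg: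
  fixes \<mu> \<nu> :: "'a::euclidean_space measure"
  assumes "\<mu> \<in> P2" "\<nu> \<in> P2"
  shows "0 \<le> W2 \<mu> \<nu>"
proof -
  have "couplings \<mu> \<nu> \<noteq> {}" using product_in_couplings[of \<mu> \<nu>] assms by (auto simp: P2_iff)
  then show ?thesis unfolding W2_def by (auto intro!: cINF_greatest)
qed

lemma W2_almost_optimal:
  fixes \<mu> \<nu> :: "'a::euclidean_space measure"
  assumes P: "\<mu> \<in> P2" "\<nu> \<in> P2" and e: "0 < e"
  obtains \<pi> where "\<pi> \<in> couplings \<mu> \<nu>" "sqrt (\<integral>z. (norm (fst z - snd z))\<^sup>2 \<partial>\<pi>) < W2 \<mu> \<nu> + e"
proof -
  let ?c = "\<lambda>\<pi>::('a \<times> 'a) measure. \<integral>z. (norm (fst z - snd z))\<^sup>2 \<partial>\<pi>"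
  have ne: "couplings \<mu> \<nu> \<noteq> {}" using product_in_couplings[of \<mu> \<nu>] P by (auto simp: P2_iff)
  then have "0 \<le> (INF \<pi>\<in>couplings \<mu> \<nu>. ?c \<pi>)" by (auto intro!: cINF_greatest)
  then have "(INF \<pi>\<in>couplings \<mu> \<nu>. ?c \<pi>) = (W2 \<mu> \<nu>)\<^sup>2" by (simp add: W2_def)
  also have "\<dots> < (W2 \<mu> \<nu> + e)\<^sup>2"
    using W2_nonneg[OF P] e by (intro power_strict_mono) auto
  finally obtain \<pi> where \<pi>: "\<pi> \<in> couplings \<mu> \<nu>" "?c \<pi> < (W2 \<mu> \<nu> + e)\<^sup>2"
    using ne by (subst (asm) cINF_less_iff) (auto intro!: bdd_belowI2[where m=0])
  have "sqrt (?c \<pi>) < W2 \<mu> \<nu> + e"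
    using real_sqrt_less_mono[OF \<pi>(2)] W2_nonneg[OF P] e by simp
  then show thesis using that \<pi>(1) by blast
qed


text \<open>The two plans are made conditionally independent given the value of \<open>s\<close> at
  the middle point. The two middle points then differ, but both are close in L2 to the same value of
  \<open>s\<close>.\<close>

lemma W2_triangle:
  fixes \<mu> \<nu> \<rho> :: "'a::euclidean_space measure"
  assumes P: "\<mu> \<in> P2" "\<nu> \<in> P2" "\<rho> \<in> P2"
  shows "W2 \<mu> \<rho> \<le> W2 \<mu> \<nu> + W2 \<nu> \<rho>"
proof (rule field_le_epsilon)
  fix e :: real assume "0 < e"
  \<comment> \<open>Four errors of e/4: two near-optimal plans, and two middle points replaced by
    values of \<open>s\<close>.\<close>
  then have e: "0 < e / 4" by simp
  obtain \<pi> where \<pi>: "\<pi> \<in> couplings \<mu> \<nu>" "sqrt (\<integral>z. (norm (fst z - snd z))\<^sup>2 \<partial>\<pi>) < W2 \<mu> \<nu> + e / 4"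
    using W2_almost_optimal[OF P(1,2) e] by blast
  obtain \<kappa> where \<kappa>: "\<kappa> \<in> couplings \<nu> \<rho>" "sqrt (\<integral>z. (norm (fst z - snd z))\<^sup>2 \<partial>\<kappa>) < W2 \<nu> \<rho> + e / 4"
    using W2_almost_optimal[OF P(2,3) e] by blast
  obtain s :: "'a \<Rightarrow> 'a" where s[measurable]: "s \<in> borel_measurable borel" and sf: "finite (range s)"
    and si: "integrable \<nu> (\<lambda>x. (norm (s x))\<^sup>2)" and sn: "sqrt (\<integral>x. (norm (x - s x))\<^sup>2 \<partial>\<nu>) \<le> e / 4"
    using simple_approx_L2[OF P(2) e] by blast
  have \<nu>: "prob_space \<nu>" "sets \<nu> = sets borel" and \<nu>i: "integrable \<nu> (\<lambda>x. (norm x)\<^sup>2)"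
    using P(2) by (auto simp: P2_iff)
  note c\<pi> = couplingsD[OF \<pi>(1)] and c\<kappa> = couplingsD[OF \<kappa>(1)]
  note [measurable_cong] = c\<pi>(2) c\<kappa>(2) \<nu>(2)
  interpret \<pi>: prob_space \<pi> by fact
  interpret \<kappa>: prob_space \<kappa> by fact
  have sp: "space \<pi> = UNIV" "space \<kappa> = UNIV"
    using sets_eq_imp_space_eq[OF c\<pi>(2)] sets_eq_imp_space_eq[OF c\<kappa>(2)] by (simp_all add: space_pair_measure)
  define p where "p v = measure \<nu> (s -` {v})" for v
  define V where "V = {v. 0 < p v}"
  note ch = charged_values[OF \<nu> s sf, folded p_def, folded V_def]
  have sv[measurable]: "s -` {v} \<in> sets borel" for v
    using measurable_sets_borel[OF s, of "{v}"] by simp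
  have sV: "{x. s x \<in> V} \<in> sets borel"
    using measurable_sets_borel[OF s, of V] ch(1) by (simp add: vimage_def finite_imp_closed borel_closed)
  \<comment> \<open>\<open>C v\<close> reads the value of \<open>s\<close> at the middle point of
    the first plan, \<open>g v\<close> at that of the second. Both have mass p v, since both middle
    marginals are \<open>\<nu>\<close>.\<close>
  define C where "C v = {z::'a \<times> 'a. s (snd z) = v}" for v
  define g where "g v z = (indicator (s -` {v}) (fst z) :: real)" for v and z :: "'a \<times> 'a"
  define w where "w = block_weight V C g p"
  define \<gamma> where "\<gamma> = density (\<pi> \<Otimes>\<^sub>M \<kappa>) (\<lambda>z. ennreal (w z))"
  have Cm[measurable]: "C v \<in> sets \<pi>" for v
  proof -
    have "C v = snd -` (s -` {v}) \<inter> space \<pi>" by (auto simp: C_def sp)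
    also have "\<dots> \<in> sets \<pi>" by measurable
    finally show ?thesis .
  qed
  have gm[measurable]: "g v \<in> borel_measurable \<kappa>" for v unfolding g_def by measurable
  have "prob_space \<gamma> \<and> distr \<gamma> \<pi> fst = \<pi> \<and> distr \<gamma> \<kappa> snd = \<kappa>"
    unfolding \<gamma>_def w_def
  proof (rule block_coupling[OF c\<pi>(1) c\<kappa>(1) ch(1) Cm _ _ gm])
    show "disjoint_family_on C V" by (auto simp: disjoint_family_on_def C_def)
    have "AE y in distr \<pi> borel snd. s y \<in> V" using ch(3) unfolding c\<pi> .
    then show "AE z in \<pi>. z \<in> (\<Union>v\<in>V. C v)"
      by (subst (asm) AE_distr_iff) (auto simp: C_def sV)
    have "AE y in distr \<kappa> borel fst. s y \<in> V" using ch(3) unfolding c\<kappa> .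
    then have "AE z in \<kappa>. s (fst z) \<in> V" by (subst (asm) AE_distr_iff) (auto simp: sV)
    then show "AE z in \<kappa>. (\<Sum>v\<in>V. g v z) = 1"
    proof eventually_elim
      case (elim z)
      have "(\<Sum>v\<in>V. g v z) = (\<Sum>v\<in>V. if s (fst z) = v then 1 else 0)"
        by (intro sum.cong) (auto simp: g_def indicator_def)
      then show ?case using ch(1) elim by simp
    qed
    fix v assume v: "v \<in> V"
    then show "0 < p v" by (simp add: V_def)
    have "p v = measure (distr \<pi> borel snd) (s -` {v})" unfolding p_def c\<pi> ..
    also have "\<dots> = measure \<pi> (C v)"
      by (subst measure_distr) (auto simp: C_def sp intro!: arg_cong[where f="measure \<pi>"])
    finally show "measure \<pi> (C v) = p v" by simp
    have "p v = (\<integral>x. indicator (s -` {v}) x \<partial>distr \<kappa> borel fst)" unfolding p_def c\<kappa> by (simp add: \<nu>)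
    also have "\<dots> = (\<integral>y. g v y \<partial>\<kappa>)" by (subst integral_distr) (auto simp: g_def[abs_def])
    finally show "(\<integral>y. g v y \<partial>\<kappa>) = p v" by simp
  qed (auto simp: g_def)
  then have b: "prob_space \<gamma>" "distr \<gamma> \<pi> fst = \<pi>" "distr \<gamma> \<kappa> snd = \<kappa>" by auto
  interpret \<gamma>: prob_space \<gamma> by (rule b)
  have wm[measurable]: "w \<in> borel_measurable (\<pi> \<Otimes>\<^sub>M \<kappa>)" unfolding w_def by measurable
  have S[measurable_cong]: "sets \<gamma> = sets (\<pi> \<Otimes>\<^sub>M \<kappa>)" by (simp add: \<gamma>_def)
  have meet: "AE z in \<gamma>. s (snd (fst z)) = s (fst (snd z))"
    unfolding \<gamma>_def
  proof (subst AE_density)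
    have "s (snd (fst z)) = s (fst (snd z))" if "0 < w z" for z
    proof (rule ccontr)
      assume "s (snd (fst z)) \<noteq> s (fst (snd z))"
      then have "w z = 0" unfolding w_def block_weight_def
        by (intro sum.neutral) (auto simp: C_def g_def indicator_def)
      then show False using that by simp
    qed
    then show "AE z in \<pi> \<Otimes>\<^sub>M \<kappa>. 0 < ennreal (w z) \<longrightarrow> s (snd (fst z)) = s (fst (snd z))" by auto
  qed measurable
  define \<sigma> where "\<sigma> = distr \<gamma> (borel \<Otimes>\<^sub>M borel) (\<lambda>z. (fst (fst z), snd (snd z)))"
  have fm: "fst \<in> measurable \<gamma> \<pi>" "snd \<in> measurable \<gamma> \<kappa>" by measurable
  have \<sigma>: "\<sigma> \<in> couplings \<mu> \<rho>"
    unfolding couplings_def mem_Collect_eq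
  proof (intro conjI)
    show "prob_space \<sigma>" unfolding \<sigma>_def by (rule \<gamma>.prob_space_distr) measurable
    show "sets \<sigma> = sets (borel \<Otimes>\<^sub>M borel)" by (simp add: \<sigma>_def)
    have "distr \<sigma> borel fst = distr (distr \<gamma> \<pi> fst) borel fst"
      unfolding \<sigma>_def by (subst (1 2) distr_distr) (auto simp: comp_def)
    then show "distr \<sigma> borel fst = \<mu>" unfolding b c\<pi> .
    have "distr \<sigma> borel snd = distr (distr \<gamma> \<kappa> snd) borel snd"
      unfolding \<sigma>_def by (subst (1 2) distr_distr) (auto simp: comp_def)
    then show "distr \<sigma> borel snd = \<rho>" unfolding b c\<kappa> .
  qed
  have int\<pi>: "(\<integral>z. f (fst z) \<partial>\<gamma>) = (\<integral>z. f z \<partial>\<pi>)" "integrable \<gamma> (\<lambda>z. f (fst z)) = integrable \<pi> f"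
    if "f \<in> borel_measurable \<pi>" for f :: "'a \<times> 'a \<Rightarrow> real"
    using integral_distr[OF fm(1) that] integrable_distr_eq[OF fm(1) that] unfolding b by auto
  have int\<kappa>: "(\<integral>z. f (snd z) \<partial>\<gamma>) = (\<integral>z. f z \<partial>\<kappa>)" "integrable \<gamma> (\<lambda>z. f (snd z)) = integrable \<kappa> f"
    if "f \<in> borel_measurable \<kappa>" for f :: "'a \<times> 'a \<Rightarrow> real"
    using integral_distr[OF fm(2) that] integrable_distr_eq[OF fm(2) that] unfolding b by auto
  have int\<nu>1: "(\<integral>z. f (snd z) \<partial>\<pi>) = (\<integral>z. f z \<partial>\<nu>)" "integrable \<pi> (\<lambda>z. f (snd z)) = integrable \<nu> f"
    if "f \<in> borel_measurable borel" for f :: "'a \<Rightarrow> real"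
    using integral_distr[of snd \<pi> borel f] integrable_distr_eq[of snd \<pi> borel f] that unfolding c\<pi> by auto
  have int\<nu>2: "(\<integral>z. f (fst z) \<partial>\<kappa>) = (\<integral>z. f z \<partial>\<nu>)" "integrable \<kappa> (\<lambda>z. f (fst z)) = integrable \<nu> f"
    if "f \<in> borel_measurable borel" for f :: "'a \<Rightarrow> real"
    using integral_distr[of fst \<kappa> borel f] integrable_distr_eq[of fst \<kappa> borel f] that unfolding c\<kappa> by auto
  have sd: "integrable \<nu> (\<lambda>x. (norm (x - s x))\<^sup>2)"
    using \<nu>i si by (intro integrable_norm_sq_diff) auto
  \<comment> \<open>Write x, y for the points of the first plan and y', z for those of the second.
    Then A + B = x - s y and D - B' = s y' - z, which add up to x - z because s y = s y' almost
    everywhere.\<close>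
  define A where "A z = fst (fst z) - snd (fst z)" for z :: "('a \<times> 'a) \<times> ('a \<times> 'a)"
  define B where "B z = snd (fst z) - s (snd (fst z))" for z :: "('a \<times> 'a) \<times> ('a \<times> 'a)"
  define B' where "B' z = fst (snd z) - s (fst (snd z))" for z :: "('a \<times> 'a) \<times> ('a \<times> 'a)"
  define D where "D z = fst (snd z) - snd (snd z)" for z :: "('a \<times> 'a) \<times> ('a \<times> 'a)"
  have [measurable]: "A \<in> borel_measurable \<gamma>" "B \<in> borel_measurable \<gamma>" "B' \<in> borel_measurable \<gamma>" "D \<in> borel_measurable \<gamma>"
    unfolding A_def B_def B'_def D_def by measurable
  have L: "integrable \<gamma> (\<lambda>z. (norm (A z))\<^sup>2)" "sqrt (\<integral>z. (norm (A z))\<^sup>2 \<partial>\<gamma>) \<le> W2 \<mu> \<nu> + e / 4"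
    using int\<pi>[of "\<lambda>z. (norm (fst z - snd z))\<^sup>2"] coupling_second_moments(3)[OF \<pi>(1) P(1,2)] \<pi>(2)
    unfolding A_def by auto
  have M: "integrable \<gamma> (\<lambda>z. (norm (D z))\<^sup>2)" "sqrt (\<integral>z. (norm (D z))\<^sup>2 \<partial>\<gamma>) \<le> W2 \<nu> \<rho> + e / 4"
    using int\<kappa>[of "\<lambda>z. (norm (fst z - snd z))\<^sup>2"] coupling_second_moments(3)[OF \<kappa>(1) P(2,3)] \<kappa>(2)
    unfolding D_def by auto
  have N: "integrable \<gamma> (\<lambda>z. (norm (B z))\<^sup>2)" "sqrt (\<integral>z. (norm (B z))\<^sup>2 \<partial>\<gamma>) \<le> e / 4"
    using int\<pi>[of "\<lambda>z. (norm (snd z - s (snd z)))\<^sup>2"] int\<nu>1[of "\<lambda>x. (norm (x - s x))\<^sup>2"] sd sn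
    unfolding B_def by auto
  have O: "integrable \<gamma> (\<lambda>z. (norm (B' z))\<^sup>2)" "sqrt (\<integral>z. (norm (B' z))\<^sup>2 \<partial>\<gamma>) \<le> e / 4"
    using int\<kappa>[of "\<lambda>z. (norm (fst z - s (fst z)))\<^sup>2"] int\<nu>2[of "\<lambda>x. (norm (x - s x))\<^sup>2"] sd sn
    unfolding B'_def by auto
  have "W2 \<mu> \<rho> \<le> sqrt (\<integral>z. (norm (fst z - snd z))\<^sup>2 \<partial>\<sigma>)" by (rule W2_le[OF \<sigma>])
  also have "(\<integral>z. (norm (fst z - snd z))\<^sup>2 \<partial>\<sigma>) = (\<integral>z. (norm (fst (fst z) - snd (snd z)))\<^sup>2 \<partial>\<gamma>)"
    unfolding \<sigma>_def by (subst integral_distr) auto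
  also have "\<dots> = (\<integral>z. (norm ((A z + B z) + (D z - B' z)))\<^sup>2 \<partial>\<gamma>)"
  proof (rule integral_cong_AE)
    show "AE z in \<gamma>. (norm (fst (fst z) - snd (snd z)))\<^sup>2 = (norm ((A z + B z) + (D z - B' z)))\<^sup>2"
      using meet by eventually_elim (simp add: A_def B_def B'_def D_def)
  qed measurable
  also have "sqrt \<dots> \<le> sqrt (\<integral>z. (norm (A z + B z))\<^sup>2 \<partial>\<gamma>) + sqrt (\<integral>z. (norm (D z - B' z))\<^sup>2 \<partial>\<gamma>)"
    using L M N O by (intro L2_minkowski integrable_norm_sq_add integrable_norm_sq_diff) auto
  also have "\<dots> \<le> (sqrt (\<integral>z. (norm (A z))\<^sup>2 \<partial>\<gamma>) + sqrt (\<integral>z. (norm (B z))\<^sup>2 \<partial>\<gamma>))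
     + (sqrt (\<integral>z. (norm (D z))\<^sup>2 \<partial>\<gamma>) + sqrt (\<integral>z. (norm (B' z))\<^sup>2 \<partial>\<gamma>))"
    using L M N O by (intro add_mono L2_minkowski L2_minkowski_diff) auto
  also have "\<dots> \<le> W2 \<mu> \<nu> + W2 \<nu> \<rho> + e" using L M N O by linarith
  finally show "W2 \<mu> \<rho> \<le> W2 \<mu> \<nu> + W2 \<nu> \<rho> + e" .
qed


section \<open>Convex order\<close>

lemma convex_on_inner: "convex_on UNIV (\<lambda>y::'a::real_inner. v \<bullet> y - c)"
  by (rule convex_onI) (auto simp: inner_add_right algebra_simps)

lemma convex_on_Max_affine:
  fixes V :: "'a::real_inner set"
  assumes V: "finite V" "V \<noteq> {}"
  shows "convex_on UNIV (\<lambda>y. MAX v\<in>V. v \<bullet> y - \<phi> v)"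
proof (rule convex_onI)
  fix t :: real and x y :: 'a assume t: "0 < t" "t < 1"
  let ?M = "\<lambda>y. MAX v\<in>V. v \<bullet> y - \<phi> v"
  have "v \<bullet> ((1 - t) *\<^sub>R x + t *\<^sub>R y) - \<phi> v \<le> (1 - t) * ?M x + t * ?M y" if "v \<in> V" for v
  proof -
    have "v \<bullet> ((1 - t) *\<^sub>R x + t *\<^sub>R y) - \<phi> v = (1 - t) * (v \<bullet> x - \<phi> v) + t * (v \<bullet> y - \<phi> v)"
      by (simp add: inner_add_right algebra_simps)
    also have "\<dots> \<le> (1 - t) * ?M x + t * ?M y"
      using t V that by (intro add_mono mult_left_mono) auto
    finally show ?thesis .
  qed
  then show "?M ((1 - t) *\<^sub>R x + t *\<^sub>R y) \<le> (1 - t) * ?M x + t * ?M y" using V by auto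
qed simp

lemma convex_orderD:
  assumes "convex_order \<mu> \<nu>" "convex_on UNIV f" "integrable \<nu> f"
  shows "integrable \<mu> f" "(\<integral>x. f x \<partial>\<mu>) \<le> (\<integral>x. f x \<partial>\<nu>)"
  using assms by (auto simp: convex_order_def)

lemma P2_integrable:
  fixes \<mu> :: "'a::euclidean_space measure"
  assumes "\<mu> \<in> P2" shows "integrable \<mu> (\<lambda>x. x)"
proof -
  have [measurable_cong]: "sets \<mu> = sets borel" using assms by (simp add: P2_iff)
  show ?thesis
    by (rule prob_space.integrable_of_norm_sq) (use assms in \<open>auto simp: P2_iff\<close>)
qed

text \<open>The squared norm is \<open>radial_excess 0\<close>.\<close>

lemma convex_order_second_moment_le:
  fixes \<mu> \<nu> :: "'a::euclidean_space measure"
  assumes "\<nu> \<in> P2" "convex_order \<mu> \<nu>"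
  shows "(\<integral>x. (norm x)\<^sup>2 \<partial>\<mu>) \<le> (\<integral>x. (norm x)\<^sup>2 \<partial>\<nu>)"
  using convex_orderD(2)[OF assms(2) convex_radial_excess[of 0]] assms(1)
  by (simp add: radial_excess_def[abs_def] P2_iff)

text \<open>Linear functionals and their negatives are both convex.\<close>

lemma convex_order_mean_eq:
  fixes \<mu> \<nu> :: "'a::euclidean_space measure"
  assumes P: "\<mu> \<in> P2" "\<nu> \<in> P2" and c: "convex_order \<mu> \<nu>"
  shows "(\<integral>x. x \<partial>\<mu>) = (\<integral>x. x \<partial>\<nu>)"
proof (rule euclidean_eqI)
  fix b :: 'a
  note i = P2_integrable[OF P(1)] P2_integrable[OF P(2)]
  have le: "(\<integral>x. x \<partial>\<mu>) \<bullet> v \<le> (\<integral>x. x \<partial>\<nu>) \<bullet> v" for v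
    using convex_orderD(2)[OF c convex_on_inner[of v 0]] i
    by (simp add: inner_commute[of v])
  from le[of b] le[of "-b"] show "(\<integral>x. x \<partial>\<mu>) \<bullet> b = (\<integral>x. x \<partial>\<nu>) \<bullet> b" by simp
qed

lemma Var_eq:
  fixes \<mu> :: "'a::euclidean_space measure"
  assumes P: "\<mu> \<in> P2"
  shows "Var \<mu> = (\<integral>x. (norm x)\<^sup>2 \<partial>\<mu>) - (norm (\<integral>x. x \<partial>\<mu>))\<^sup>2"
proof -
  interpret prob_space \<mu> using P by (simp add: P2_iff)
  define m where "m = (\<integral>x. x \<partial>\<mu>)"
  have i: "integrable \<mu> (\<lambda>x. (norm x)\<^sup>2)" "integrable \<mu> (\<lambda>x. x)"
    using P P2_integrable[OF P] by (auto simp: P2_iff)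
  have "Var \<mu> = (\<integral>x. (norm x)\<^sup>2 - 2 * (m \<bullet> x) + (norm m)\<^sup>2 \<partial>\<mu>)"
    unfolding Var_def m_def[symmetric]
    by (simp add: power2_norm_eq_inner inner_diff_left inner_diff_right inner_commute algebra_simps)
  also have "\<dots> = (\<integral>x. (norm x)\<^sup>2 \<partial>\<mu>) - 2 * (m \<bullet> m) + (norm m)\<^sup>2"
    using i by (simp add: m_def prob_space)
  finally show ?thesis by (simp add: m_def power2_norm_eq_inner)
qed

lemma convex_order_Var_diff:
  fixes \<mu> \<nu> :: "'a::euclidean_space measure"
  assumes P: "\<mu> \<in> P2" "\<nu> \<in> P2" and c: "convex_order \<mu> \<nu>"
  shows "Var \<nu> - Var \<mu> = (\<integral>x. (norm x)\<^sup>2 \<partial>\<nu>) - (\<integral>x. (norm x)\<^sup>2 \<partial>\<mu>)"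
  using convex_order_mean_eq[OF P c] by (simp add: Var_eq P)

text \<open>Given the level set of \<open>s\<close>, the two coordinates are independent; the second one has density
  the softmax weight of that level set, normalized by its mass.\<close>

lemma convex_order_correlated_coupling:
  fixes \<mu> \<nu> :: "'a::euclidean_space measure"
  assumes P: "\<mu> \<in> P2" "\<nu> \<in> P2" and co: "convex_order \<mu> \<nu>" and d: "0 < \<delta>"
    and s[measurable]: "s \<in> borel_measurable borel" and sf: "finite (range s)"
    and s2: "integrable \<mu> (\<lambda>x. (norm (s x))\<^sup>2)"
  shows "\<exists>\<pi>\<in>couplings \<mu> \<nu>. integrable \<pi> (\<lambda>z. s (fst z) \<bullet> snd z)
    \<and> (\<integral>x. s x \<bullet> x \<partial>\<mu>) - \<delta> \<le> (\<integral>z. s (fst z) \<bullet> snd z \<partial>\<pi>)"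
proof -
  have \<mu>: "prob_space \<mu>" "sets \<mu> = sets borel" and \<nu>: "prob_space \<nu>" "sets \<nu> = sets borel"
    using P by (auto simp: P2_iff)
  note [measurable_cong] = \<mu>(2) \<nu>(2)
  interpret \<mu>: prob_space \<mu> by fact
  interpret \<nu>: prob_space \<nu> by fact
  note i = P2_integrable[OF P(1)] P2_integrable[OF P(2)]
  define p where "p v = measure \<mu> (s -` {v})" for v
  define V where "V = {v. 0 < p v}"
  note ch = charged_values[OF \<mu> s sf, folded p_def, folded V_def]
  have p0: "0 < p v" if "v \<in> V" for v using that by (simp add: V_def)
  have C[measurable]: "s -` {v} \<in> sets \<mu>" for v
    using measurable_sets_borel[OF s, of "{v}"] \<mu>(2) by simp
  have Ci: "integrable \<mu> (indicat_real (s -` {v}))" for v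
    by (intro integrable_real_indicator C) (simp add: less_top[symmetric])
  \<comment> \<open>Makes the total loss \<open>\<epsilon> * card V\<close> of the softmax average
    equal to \<open>\<delta>\<close>.\<close>
  define \<epsilon> where "\<epsilon> = \<delta> / card V"
  have e: "0 < \<epsilon>" "\<epsilon> * card V = \<delta>" using d ch(1,2) by (auto simp: \<epsilon>_def card_gt_0_iff)
  obtain \<phi> where \<phi>: "\<And>v. v \<in> V \<Longrightarrow> (\<integral>y. softmax \<epsilon> V \<phi> v y \<partial>\<nu>) = p v"
    using softmax_potential_exists[OF ch(1,2) e(1) \<nu> i(2), of p] p0 ch(4) by blast
  define q where "q = softmax \<epsilon> V \<phi>"
  have q[measurable]: "q v \<in> borel_measurable \<nu>" for v unfolding q_def by measurable
  define w where "w = block_weight V (\<lambda>v. s -` {v}) q p"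
  define \<pi> where "\<pi> = density (\<mu> \<Otimes>\<^sub>M \<nu>) (\<lambda>z. ennreal (w z))"
  have "prob_space \<pi> \<and> distr \<pi> \<mu> fst = \<mu> \<and> distr \<pi> \<nu> snd = \<nu>"
    unfolding \<pi>_def w_def
  proof (rule block_coupling[OF \<mu>(1) \<nu>(1) ch(1) C _ _ q])
    show "disjoint_family_on (\<lambda>v. s -` {v}) V" by (auto simp: disjoint_family_on_def)
    show "AE x in \<mu>. x \<in> (\<Union>v\<in>V. s -` {v})" using ch(3) by eventually_elim auto
  qed (use p0 \<phi> softmax_nonneg[OF ch(1)] softmax_sum[OF ch(1,2)] in \<open>auto simp: q_def p_def\<close>)
  then have b: "prob_space \<pi>" "distr \<pi> \<mu> fst = \<mu>" "distr \<pi> \<nu> snd = \<nu>" by auto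
  have "distr \<pi> \<mu> fst = distr \<pi> borel fst" "distr \<pi> \<nu> snd = distr \<pi> borel snd"
    using \<mu>(2) \<nu>(2) by (auto intro!: distr_cong)
  then have \<pi>: "\<pi> \<in> couplings \<mu> \<nu>"
    unfolding couplings_def using b sets_pair_measure_cong[OF \<mu>(2) \<nu>(2)] by (simp add: \<pi>_def)
  have w0: "0 \<le> w z" for z
    unfolding w_def block_weight_def q_def using softmax_nonneg[OF ch(1)] p0
    by (intro sum_nonneg mult_nonneg_nonneg divide_nonneg_nonneg) (auto simp: less_imp_le)
  have wm[measurable]: "w \<in> borel_measurable (\<mu> \<Otimes>\<^sub>M \<nu>)" unfolding w_def by measurable
  \<comment> \<open>On the block of v the vector s x is v, so the correlation is a finite sum of
    products of a function of x and a function of y.\<close>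
  have wz: "w z * (s (fst z) \<bullet> snd z)
      = (\<Sum>v\<in>V. indicator (s -` {v}) (fst z) * (q v (snd z) * (v \<bullet> snd z) / p v))" for z
    unfolding w_def block_weight_def sum_distrib_right
    by (intro sum.cong) (auto simp: indicator_def)
  have qi: "integrable \<nu> (\<lambda>y. q v y * (v \<bullet> y))" if v: "v \<in> V" for v
  proof (rule Bochner_Integration.integrable_bound)
    show "integrable \<nu> (\<lambda>y. v \<bullet> y)" using i(2) by simp
    show "AE y in \<nu>. norm (q v y * (v \<bullet> y)) \<le> norm (v \<bullet> y)"
      using softmax_le_1[OF ch(1) v] softmax_nonneg[OF ch(1)]
      by (auto simp: q_def abs_mult intro!: mult_left_le_one_le)
  qed measurable
  have qi1: "integrable \<nu> (q v)" if v: "v \<in> V" for v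
    using softmax_nonneg[OF ch(1)] softmax_le_1[OF ch(1) v]
    by (intro \<nu>.integrable_const_bound[where B=1]) (auto simp: q_def)
  have int: "integrable (\<mu> \<Otimes>\<^sub>M \<nu>) (\<lambda>z. indicator (s -` {v}) (fst z) * (q v (snd z) * (v \<bullet> snd z) / p v))"
    "(\<integral>z. indicator (s -` {v}) (fst z) * (q v (snd z) * (v \<bullet> snd z) / p v) \<partial>(\<mu> \<Otimes>\<^sub>M \<nu>)) = (\<integral>y. q v y * (v \<bullet> y) \<partial>\<nu>)"
    if v: "v \<in> V" for v
  proof -
    have k: "integrable \<nu> (\<lambda>y. q v y * (v \<bullet> y) / p v)" using qi[OF v] by simp
    show "integrable (\<mu> \<Otimes>\<^sub>M \<nu>) (\<lambda>z. indicator (s -` {v}) (fst z) * (q v (snd z) * (v \<bullet> snd z) / p v))"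
      using integrable_pair_mult[OF \<mu>(1) \<nu>(1) Ci[of v] k] .
    have "measure \<mu> (s -` {v}) = p v" by (simp add: p_def)
    then show "(\<integral>z. indicator (s -` {v}) (fst z) * (q v (snd z) * (v \<bullet> snd z) / p v) \<partial>(\<mu> \<Otimes>\<^sub>M \<nu>)) = (\<integral>y. q v y * (v \<bullet> y) \<partial>\<nu>)"
      using integral_pair_mult[OF \<mu>(1) \<nu>(1) Ci[of v] k] p0[OF v] by simp
  qed
  have intw: "integrable (\<mu> \<Otimes>\<^sub>M \<nu>) (\<lambda>z. w z * (s (fst z) \<bullet> snd z))"
    unfolding wz by (intro Bochner_Integration.integrable_sum int)
  have int\<pi>: "integrable \<pi> (\<lambda>z. s (fst z) \<bullet> snd z)"
    unfolding \<pi>_def using intw by (subst integrable_density) (auto simp: w0)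
  have "(\<integral>z. s (fst z) \<bullet> snd z \<partial>\<pi>) = (\<integral>z. w z * (s (fst z) \<bullet> snd z) \<partial>(\<mu> \<Otimes>\<^sub>M \<nu>))"
    unfolding \<pi>_def by (subst integral_density) (auto simp: w0)
  also have "\<dots> = (\<Sum>v\<in>V. \<integral>y. q v y * (v \<bullet> y) \<partial>\<nu>)"
    unfolding wz by (subst Bochner_Integration.integral_sum) (auto simp: int simp del: times_divide_eq_right)
  \<comment> \<open>Inserting \<open>\<phi>\<close> costs nothing: the softmax weights have
    integrals p v, so what is subtracted under the integral returns as the linear part of the dual
    value.\<close>
  also have "\<dots> = (\<Sum>v\<in>V. (\<integral>y. q v y * (v \<bullet> y - \<phi> v) \<partial>\<nu>) + p v * \<phi> v)"
  proof (rule sum.cong)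
    fix v assume v: "v \<in> V"
    have "(\<integral>y. q v y * (v \<bullet> y - \<phi> v) \<partial>\<nu>) = (\<integral>y. q v y * (v \<bullet> y) \<partial>\<nu>) - (\<integral>y. q v y \<partial>\<nu>) * \<phi> v"
      using qi[OF v] qi1[OF v] by (simp add: right_diff_distrib)
    then show "(\<integral>y. q v y * (v \<bullet> y) \<partial>\<nu>) = (\<integral>y. q v y * (v \<bullet> y - \<phi> v) \<partial>\<nu>) + p v * \<phi> v"
      using \<phi>[OF v] by (simp add: q_def)
  qed simp
  also have "\<dots> = (\<integral>y. (\<Sum>v\<in>V. q v y * (v \<bullet> y - \<phi> v)) \<partial>\<nu>) + (\<Sum>v\<in>V. p v * \<phi> v)"
    using qi qi1 by (subst Bochner_Integration.integral_sum) (auto simp: sum.distrib right_diff_distrib)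
  finally have cost: "(\<integral>z. s (fst z) \<bullet> snd z \<partial>\<pi>)
      = (\<integral>y. (\<Sum>v\<in>V. q v y * (v \<bullet> y - \<phi> v)) \<partial>\<nu>) + (\<Sum>v\<in>V. p v * \<phi> v)" .
  \<comment> \<open>The unregularized maximum is convex, so convex order applies to it directly. It
    lies below the log-sum-exp, hence below the softmax average plus
    \<open>\<delta>\<close>.\<close>
  define \<psi> where "\<psi> y = (MAX v\<in>V. v \<bullet> y - \<phi> v)" for y
  have \<psi>_le: "\<psi> y \<le> (\<Sum>v\<in>V. q v y * (v \<bullet> y - \<phi> v)) + \<delta>" for y
  proof -
    have "\<psi> y \<le> log_sum_exp \<epsilon> V \<phi> y"
      unfolding \<psi>_def using ch(1,2) log_sum_exp_ge[OF ch(1) _ e(1)] by auto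
    also have "\<dots> \<le> (\<Sum>v\<in>V. q v y * (v \<bullet> y - \<phi> v)) + \<delta>"
      using log_sum_exp_le_softmax_average[OF ch(1,2) e(1), of \<phi> y] e(2) by (simp add: q_def)
    finally show ?thesis .
  qed
  have \<psi>c: "convex_on UNIV \<psi>" unfolding \<psi>_def by (rule convex_on_Max_affine[OF ch(1,2)])
  have \<psi>m: "\<psi> \<in> borel_measurable borel"
    using convex_on_continuous[OF open_UNIV \<psi>c] by (rule borel_measurable_continuous_onI)
  have \<psi>\<nu>: "integrable \<nu> \<psi>"
  proof (rule Bochner_Integration.integrable_bound)
    show "integrable \<nu> (\<lambda>y. \<Sum>v\<in>V. \<bar>v \<bullet> y - \<phi> v\<bar>)"
      using i(2) by (intro Bochner_Integration.integrable_sum integrable_abs Bochner_Integration.integrable_diff) auto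
    have "\<bar>\<psi> y\<bar> \<le> (\<Sum>v\<in>V. \<bar>v \<bullet> y - \<phi> v\<bar>)" for y
    proof -
      have "\<psi> y \<in> (\<lambda>v. v \<bullet> y - \<phi> v) ` V" unfolding \<psi>_def using ch(1,2) by (intro Max_in) auto
      then obtain u where "u \<in> V" "\<psi> y = u \<bullet> y - \<phi> u" by auto
      then show ?thesis using member_le_sum[of u V "\<lambda>v. \<bar>v \<bullet> y - \<phi> v\<bar>"] ch(1) by simp
    qed
    then show "AE y in \<nu>. norm (\<psi> y) \<le> norm (\<Sum>v\<in>V. \<bar>v \<bullet> y - \<phi> v\<bar>)"
      by (auto intro: order_trans[OF _ abs_ge_self])
  qed (use \<psi>m in simp)
  note \<psi>\<mu> = convex_orderD[OF co \<psi>c \<psi>\<nu>]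
  have six: "integrable \<mu> (\<lambda>x. s x \<bullet> x)"
  proof (rule Bochner_Integration.integrable_bound)
    show "integrable \<mu> (\<lambda>x. (norm (s x))\<^sup>2 + (norm x)\<^sup>2)" using P s2 by (auto simp: P2_iff)
    have "\<bar>a \<bullet> c\<bar> \<le> (norm a)\<^sup>2 + (norm c)\<^sup>2" for a c :: 'a
    proof -
      have "\<bar>a \<bullet> c\<bar> \<le> norm a * norm c" by (rule Cauchy_Schwarz_ineq2)
      also have "\<dots> \<le> (norm a)\<^sup>2 + (norm c)\<^sup>2"
        using sum_squares_bound[of "norm a" "norm c"] mult_nonneg_nonneg[OF norm_ge_zero[of a] norm_ge_zero[of c]]
        by linarith
      finally show ?thesis .
    qed
    then show "AE x in \<mu>. norm (s x \<bullet> x) \<le> norm ((norm (s x))\<^sup>2 + (norm x)\<^sup>2)" by (auto simp: abs_of_nonneg)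
  qed measurable
  have ind: "(\<Sum>v\<in>V. indicator (s -` {v}) x * \<phi> v) = \<phi> (s x)" if "s x \<in> V" for x
  proof -
    have "(\<Sum>v\<in>V. indicator (s -` {v}) x * \<phi> v) = (\<Sum>v\<in>V. if s x = v then \<phi> v else 0)"
      by (intro sum.cong) (auto simp: indicator_def)
    then show ?thesis using ch(1) that by simp
  qed
  \<comment> \<open>Testing the maximum \<open>\<psi> x\<close> with the particular value v = s x
    gives the pointwise lower bound; its potential term integrates to the linear part of the dual
    value.\<close>
  have "(\<integral>x. s x \<bullet> x \<partial>\<mu>) - (\<Sum>v\<in>V. p v * \<phi> v) = (\<integral>x. s x \<bullet> x - (\<Sum>v\<in>V. indicator (s -` {v}) x * \<phi> v) \<partial>\<mu>)"
    using six Ci by (simp add: p_def)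
  also have "\<dots> \<le> (\<integral>x. \<psi> x \<partial>\<mu>)"
  proof (rule integral_mono_AE)
    show "integrable \<mu> (\<lambda>x. s x \<bullet> x - (\<Sum>v\<in>V. indicator (s -` {v}) x * \<phi> v))"
      using six Ci by (intro Bochner_Integration.integrable_diff Bochner_Integration.integrable_sum) auto
    show "AE x in \<mu>. s x \<bullet> x - (\<Sum>v\<in>V. indicator (s -` {v}) x * \<phi> v) \<le> \<psi> x"
      using ch(3)
    proof eventually_elim
      case (elim x)
      show ?case unfolding ind[OF elim] \<psi>_def using ch(1) elim by (intro Max_ge) auto
    qed
  qed (rule \<psi>\<mu>)
  also have "\<dots> \<le> (\<integral>y. \<psi> y \<partial>\<nu>)" by (rule \<psi>\<mu>)
  also have "\<dots> \<le> (\<integral>y. (\<Sum>v\<in>V. q v y * (v \<bullet> y - \<phi> v)) + \<delta> \<partial>\<nu>)"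
    using \<psi>\<nu> qi qi1 by (intro integral_mono \<psi>_le) (auto simp: right_diff_distrib)
  also have "\<dots> = (\<integral>y. (\<Sum>v\<in>V. q v y * (v \<bullet> y - \<phi> v)) \<partial>\<nu>) + \<delta>"
    using qi qi1 by (subst Bochner_Integration.integral_add) (auto simp: right_diff_distrib \<nu>.prob_space)
  finally show ?thesis using cost \<pi> int\<pi> by (intro bexI[of _ \<pi>]) auto
qed

text \<open>For a coupling with E(x . y) \<ge> E |x|^2, expanding E |x - y|^2 gives at most E |y|^2
  - E |x|^2, the difference of the variances. The proof runs this with s x in place of x and pays
  for |x - s x|.\<close>

lemma W2_le_of_convex_order:
  fixes \<mu> \<nu> :: "'a::euclidean_space measure"
  assumes P: "\<mu> \<in> P2" "\<nu> \<in> P2" and co: "convex_order \<mu> \<nu>"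
  shows "W2 \<mu> \<nu> \<le> sqrt (Var \<nu> - Var \<mu>)"
proof (rule field_le_epsilon)
  fix e :: real assume "0 < e"
  then have e: "0 < e / 3" by simp
  define D where "D = Var \<nu> - Var \<mu>"
  have D: "D = (\<integral>y. (norm y)\<^sup>2 \<partial>\<nu>) - (\<integral>x. (norm x)\<^sup>2 \<partial>\<mu>)"
    unfolding D_def by (rule convex_order_Var_diff[OF P co])
  have D0: "0 \<le> D" using convex_order_second_moment_le[OF P(2) co] by (simp add: D)
  obtain s :: "'a \<Rightarrow> 'a" where s[measurable]: "s \<in> borel_measurable borel" and sf: "finite (range s)"
    and s2: "integrable \<mu> (\<lambda>x. (norm (s x))\<^sup>2)" and sn: "sqrt (\<integral>x. (norm (x - s x))\<^sup>2 \<partial>\<mu>) \<le> e / 3"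
    using simple_approx_L2[OF P(1) e] by blast
  obtain \<pi> where \<pi>: "\<pi> \<in> couplings \<mu> \<nu>" and i\<pi>: "integrable \<pi> (\<lambda>z. s (fst z) \<bullet> snd z)"
    and c: "(\<integral>x. s x \<bullet> x \<partial>\<mu>) - (e / 3)\<^sup>2 \<le> (\<integral>z. s (fst z) \<bullet> snd z \<partial>\<pi>)"
    using convex_order_correlated_coupling[OF P co _ s sf s2, of "(e / 3)\<^sup>2"] e by auto
  have [measurable_cong]: "sets \<mu> = sets borel" "sets \<nu> = sets borel" using P by (auto simp: P2_iff)
  note c\<pi> = couplingsD[OF \<pi>] and m\<pi> = coupling_second_moments[OF \<pi> P]
  note [measurable_cong] = c\<pi>(2)
  have x2: "integrable \<mu> (\<lambda>x. (norm x)\<^sup>2)" using P by (auto simp: P2_iff)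
  have int\<mu>: "(\<integral>z. f (fst z) \<partial>\<pi>) = (\<integral>z. f z \<partial>\<mu>)" "integrable \<pi> (\<lambda>z. f (fst z)) = integrable \<mu> f"
    if "f \<in> borel_measurable borel" for f :: "'a \<Rightarrow> real"
    using integral_distr[of fst \<pi> borel f] integrable_distr_eq[of fst \<pi> borel f] that unfolding c\<pi> by auto
  have int\<nu>: "(\<integral>z. f (snd z) \<partial>\<pi>) = (\<integral>z. f z \<partial>\<nu>)"
    if "f \<in> borel_measurable borel" for f :: "'a \<Rightarrow> real"
    using integral_distr[of snd \<pi> borel f] that unfolding c\<pi> by auto
  have xs2: "integrable \<mu> (\<lambda>x. (norm (x - s x))\<^sup>2)" using x2 s2 by (intro integrable_norm_sq_diff) auto
  have pol: "2 * (a \<bullet> b) = (norm a)\<^sup>2 + (norm b)\<^sup>2 - (norm (b - a))\<^sup>2" for a b :: 'a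
    by (simp add: power2_norm_eq_inner inner_diff_left inner_diff_right inner_commute)
  have sx: "2 * (\<integral>x. s x \<bullet> x \<partial>\<mu>) = (\<integral>x. (norm (s x))\<^sup>2 \<partial>\<mu>) + (\<integral>x. (norm x)\<^sup>2 \<partial>\<mu>) - (\<integral>x. (norm (x - s x))\<^sup>2 \<partial>\<mu>)"
  proof -
    have "2 * (\<integral>x. s x \<bullet> x \<partial>\<mu>) = (\<integral>x. 2 * (s x \<bullet> x) \<partial>\<mu>)" by simp
    also have "\<dots> = (\<integral>x. (norm (s x))\<^sup>2 + (norm x)\<^sup>2 - (norm (x - s x))\<^sup>2 \<partial>\<mu>)" unfolding pol ..
    finally show ?thesis using s2 x2 xs2 by simp
  qed
  have s\<pi>: "integrable \<pi> (\<lambda>z. (norm (s (fst z)))\<^sup>2)" "integrable \<pi> (\<lambda>z. (norm (fst z - s (fst z)))\<^sup>2)"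
    using int\<mu>(2)[of "\<lambda>x. (norm (s x))\<^sup>2"] int\<mu>(2)[of "\<lambda>x. (norm (x - s x))\<^sup>2"] s2 xs2 by auto
  have "(norm (s a - b))\<^sup>2 = (norm (s a))\<^sup>2 + (norm b)\<^sup>2 - 2 * (s a \<bullet> b)" for a b
    using pol[of "s a" b] by (simp add: norm_minus_commute)
  then have "(\<integral>z. (norm (s (fst z) - snd z))\<^sup>2 \<partial>\<pi>)
      = (\<integral>z. (norm (s (fst z)))\<^sup>2 + (norm (snd z))\<^sup>2 - 2 * (s (fst z) \<bullet> snd z) \<partial>\<pi>)" by simp
  also have "\<dots> = (\<integral>z. (norm (s (fst z)))\<^sup>2 \<partial>\<pi>) + (\<integral>z. (norm (snd z))\<^sup>2 \<partial>\<pi>) - 2 * (\<integral>z. s (fst z) \<bullet> snd z \<partial>\<pi>)"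
    using s\<pi> m\<pi> i\<pi> by simp
  also have "\<dots> = (\<integral>x. (norm (s x))\<^sup>2 \<partial>\<mu>) + (\<integral>x. (norm x)\<^sup>2 \<partial>\<nu>) - 2 * (\<integral>z. s (fst z) \<bullet> snd z \<partial>\<pi>)"
    using int\<mu>(1)[of "\<lambda>x. (norm (s x))\<^sup>2"] int\<nu>[of "\<lambda>x. (norm x)\<^sup>2"] by simp
  \<comment> \<open>Replacing s . y by s . x and polarizing, the term |s x|^2 cancels. What remains
    is \<open>D\<close>, the approximation error and twice the loss in the correlation.\<close>
  also have "\<dots> \<le> D + (\<integral>x. (norm (x - s x))\<^sup>2 \<partial>\<mu>) + 2 * (e / 3)\<^sup>2"
    using c sx D by linarith
  also have "(\<integral>x. (norm (x - s x))\<^sup>2 \<partial>\<mu>) \<le> (e / 3)\<^sup>2"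
    using sqrt_le_D[OF sn] by simp
  finally have le: "(\<integral>z. (norm (s (fst z) - snd z))\<^sup>2 \<partial>\<pi>) \<le> D + 3 * (e / 3)\<^sup>2" by simp
  have "W2 \<mu> \<nu> \<le> sqrt (\<integral>z. (norm (fst z - snd z))\<^sup>2 \<partial>\<pi>)" by (rule W2_le[OF \<pi>])
  also have "\<dots> = sqrt (\<integral>z. (norm ((fst z - s (fst z)) + (s (fst z) - snd z)))\<^sup>2 \<partial>\<pi>)" by simp
  also have "\<dots> \<le> sqrt (\<integral>z. (norm (fst z - s (fst z)))\<^sup>2 \<partial>\<pi>) + sqrt (\<integral>z. (norm (s (fst z) - snd z))\<^sup>2 \<partial>\<pi>)"
    using s\<pi> m\<pi> by (intro L2_minkowski integrable_norm_sq_diff) auto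
  also have "\<dots> \<le> e / 3 + sqrt (D + 3 * (e / 3)\<^sup>2)"
    using le sn int\<mu>(1)[of "\<lambda>x. (norm (x - s x))\<^sup>2"] by (intro add_mono real_sqrt_le_mono) auto
  \<comment> \<open>With h = e/3, the square of sqrt D + 2h is at least D + 4h^2, which absorbs
    3h^2; with the earlier h the total error is e.\<close>
  also have "sqrt (D + 3 * (e / 3)\<^sup>2) \<le> sqrt D + 2 * (e / 3)"
  proof (rule real_le_lsqrt)
    show "D + 3 * (e / 3)\<^sup>2 \<le> (sqrt D + 2 * (e / 3))\<^sup>2"
    proof -
      have "(sqrt D + 2 * (e / 3))\<^sup>2 = D + 4 * (e / 3)\<^sup>2 + 4 * (sqrt D * (e / 3))"
        using D0 by (simp add: power2_sum power_mult_distrib power_divide)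
      moreover have "0 \<le> sqrt D * (e / 3)" using D0 e by (intro mult_nonneg_nonneg) auto
      ultimately show ?thesis using zero_le_power2[of "e / 3"] by linarith
    qed
  qed (use D0 e in auto)
  finally show "W2 \<mu> \<nu> \<le> sqrt (Var \<nu> - Var \<mu>) + e" by (simp add: D_def)
qed


section \<open>Compactness\<close>

text \<open>\<open>f\<close> is bounded on the unit ball. For |x| = n > 1, the point x / n of that
  ball lies between 0 and x, and convexity there bounds f x from below linearly in n.\<close>

lemma convex_on_lower_bound:
  fixes f :: "'a::euclidean_space \<Rightarrow> real"
  assumes f: "convex_on UNIV f"
  shows "\<exists>K\<ge>0. \<forall>x. - K * (1 + norm x) \<le> f x"
proof -
  have "bounded (f ` cball 0 1)"
    using continuous_on_subset[OF convex_on_continuous[OF open_UNIV f]]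
    by (intro compact_imp_bounded compact_continuous_image) auto
  then obtain K where "\<forall>x\<in>cball 0 1. \<bar>f x\<bar> \<le> K"
    unfolding bounded_iff by auto
  then have K: "\<bar>f x\<bar> \<le> K" if "norm x \<le> 1" for x using that by simp
  have K0: "0 \<le> K" using K[of 0] by simp
  have "- (2 * K) * (1 + norm x) \<le> f x" for x
  proof (cases "norm x \<le> 1")
    case True
    have "K * 1 \<le> (2 * K) * (1 + norm x)" using K0 by (intro mult_mono) auto
    then show ?thesis using K[OF True] by simp
  next
    case False
    define n where "n = norm x"
    have n: "1 < n" using False by (simp add: n_def)
    have "f ((1 - 1 / n) *\<^sub>R 0 + (1 / n) *\<^sub>R x) \<le> (1 - 1 / n) * f 0 + (1 / n) * f x"
      using n by (intro convex_onD[OF f]) auto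
    then have "n * f ((1 / n) *\<^sub>R x) \<le> n * ((1 - 1 / n) * f 0 + (1 / n) * f x)"
      using n by (intro mult_left_mono) auto
    also have "\<dots> = (n - 1) * f 0 + f x" using n by (simp add: field_simps)
    finally have "n * f ((1 / n) *\<^sub>R x) - (n - 1) * f 0 \<le> f x" by simp
    moreover have "n * (- K) \<le> n * f ((1 / n) *\<^sub>R x)"
    proof (intro mult_left_mono)
      have "norm ((1 / n) *\<^sub>R x) \<le> 1" using n by (simp add: n_def)
      from K[OF this] show "- K \<le> f ((1 / n) *\<^sub>R x)" by linarith
    qed (use n in simp)
    moreover have "(n - 1) * f 0 \<le> (n - 1) * K"
      using K[of 0] n by (intro mult_left_mono) auto
    ultimately have "- (2 * n - 1) * K \<le> f x" by (simp add: algebra_simps)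
    moreover have "(2 * n - 1) * K \<le> (2 * (1 + n)) * K" using K0 by (intro mult_right_mono) auto
    ultimately show ?thesis by (simp add: n_def algebra_simps)
  qed
  then show ?thesis using K0 by (intro exI[of _ "2 * K"]) auto
qed

lemma radial_excess_integral_tendsto_0:
  fixes \<nu> :: "'a::euclidean_space measure"
  assumes \<nu>: "\<nu> \<in> P2"
  shows "(\<lambda>n. \<integral>x. radial_excess (real n) x \<partial>\<nu>) \<longlonglongrightarrow> 0"
proof -
  have [measurable_cong]: "sets \<nu> = sets borel" using \<nu> by (simp add: P2_iff)
  have [measurable]: "radial_excess R \<in> borel_measurable (borel :: 'a measure)" for R
    using continuous_radial_excess by (rule borel_measurable_continuous_onI)
  have "(\<lambda>n. \<integral>x. radial_excess (real n) x \<partial>\<nu>) \<longlonglongrightarrow> (\<integral>x. 0 \<partial>\<nu>)"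
  proof (rule integral_dominated_convergence[where w="\<lambda>x. (norm x)\<^sup>2"])
    show "AE x in \<nu>. (\<lambda>n. radial_excess (real n) x) \<longlonglongrightarrow> 0"
    proof (rule AE_I2, rule tendsto_eventually)
      fix x :: 'a
      obtain N where N: "norm x \<le> real N" using real_arch_simple by blast
      then show "eventually (\<lambda>n. radial_excess (real n) x = 0) sequentially"
        unfolding eventually_sequentially
        by (intro exI[of _ N]) (auto simp: radial_excess_def max_def)
    qed
  qed (use \<nu> radial_excess_le[of "real _"] in \<open>auto simp: P2_iff\<close>)
  then show ?thesis by simp
qed

text \<open>Almost sure convergence improves to L2 convergence because the tails of all laws are
  dominated by those of \<open>\<nu>\<close>. One realization then serves for convex order,
  \<open>W2\<close> and variance at once.\<close>

lemma M_nu_sequentially_compact: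
  fixes \<nu> :: "'a::euclidean_space measure"
  assumes \<nu>: "\<nu> \<in> P2" and \<mu>: "\<And>n. \<mu> n \<in> M_nu \<nu>"
  obtains r \<mu>' where "strict_mono (r :: nat \<Rightarrow> nat)" "\<mu>' \<in> M_nu \<nu>"
    "(\<lambda>n. W2 (\<mu> (r n)) \<mu>') \<longlonglongrightarrow> 0" "(\<lambda>n. Var (\<mu> (r n))) \<longlonglongrightarrow> Var \<mu>'"
proof -
  have \<mu>P: "\<mu> n \<in> P2" and \<mu>c: "convex_order (\<mu> n) \<nu>" for n using \<mu> by (auto simp: M_nu_def)
  obtain r \<Omega> X Y where r: "strict_mono (r :: nat \<Rightarrow> nat)" and \<Omega>: "prob_space (\<Omega> :: real measure)"
    and X[measurable]: "\<And>n. X n \<in> borel_measurable \<Omega>" and Y[measurable]: "Y \<in> borel_measurable \<Omega>"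
    and dX: "\<And>n. distr \<Omega> borel (X n) = \<mu> (r n)" and lim: "AE w in \<Omega>. (\<lambda>n. X n w) \<longlonglongrightarrow> Y w"
    by (rule Skorohod_subsequence[OF \<mu>P convex_order_second_moment_le[OF \<nu> \<mu>c]]) (rule that)
  interpret prob_space \<Omega> by fact
  define \<mu>' where "\<mu>' = distr \<Omega> borel Y"
  have [measurable_cong]: "sets \<nu> = sets borel" using \<nu> by (simp add: P2_iff)
  have exm[measurable]: "radial_excess R \<in> borel_measurable (borel :: 'a measure)" for R
    using continuous_radial_excess by (rule borel_measurable_continuous_onI)
  have intX: "(\<integral>w. f (X n w) \<partial>\<Omega>) = (\<integral>x. f x \<partial>\<mu> (r n))" "integrable \<Omega> (\<lambda>w. f (X n w)) = integrable (\<mu> (r n)) f"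
    if "f \<in> borel_measurable borel" for f :: "'a \<Rightarrow> real" and n
    using integral_distr[OF X that] integrable_distr_eq[OF X that] unfolding dX by auto
  have intY: "(\<integral>w. f (Y w) \<partial>\<Omega>) = (\<integral>x. f x \<partial>\<mu>')" "integrable \<Omega> (\<lambda>w. f (Y w)) = integrable \<mu>' f"
    if "f \<in> borel_measurable borel" for f :: "'a \<Rightarrow> real"
    using integral_distr[OF Y that] integrable_distr_eq[OF Y that] unfolding \<mu>'_def by auto
  have X2: "integrable \<Omega> (\<lambda>w. (norm (X n w))\<^sup>2)" for n
    using \<mu>P[of "r n"] by (subst intX(2)) (auto simp: P2_iff)
  have unif: "\<exists>R>0. \<forall>n. (\<integral>w. radial_excess R (X n w) \<partial>\<Omega>) \<le> e" if e: "0 < e" for e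
  proof -
    have "eventually (\<lambda>n. (\<integral>x. radial_excess (real n) x \<partial>\<nu>) < e \<and> 0 < n) sequentially"
      using order_tendstoD(2)[OF radial_excess_integral_tendsto_0[OF \<nu>] e] eventually_gt_at_top[of 0]
      by eventually_elim auto
    then obtain N where N: "(\<integral>x. radial_excess (real N) x \<partial>\<nu>) < e" "0 < N"
      by (auto simp: eventually_sequentially)
    have "integrable \<nu> (radial_excess (real N))"
      by (rule Bochner_Integration.integrable_bound[of _ "\<lambda>x. (norm x)\<^sup>2"])
        (use \<nu> radial_excess_le[of "real N"] in \<open>auto simp: P2_iff\<close>)
    from convex_orderD(2)[OF \<mu>c convex_radial_excess this]
    have "(\<integral>w. radial_excess (real N) (X n w) \<partial>\<Omega>) \<le> e" for n
      using N(1) intX(1)[OF exm, of "real N" n] by (metis less_eq_real_def order_trans)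
    then show ?thesis using N(2) by (intro exI[of _ "real N"]) auto
  qed
  note conv = L2_convergence_of_radial_excess[OF X Y lim X2 unif]
  have XY2: "integrable \<Omega> (\<lambda>w. (norm (X n w - Y w))\<^sup>2)" for n
    using X2 conv(1) by (intro integrable_norm_sq_diff) auto
  define \<Delta> where "\<Delta> n = sqrt (\<integral>w. (norm (X n w - Y w))\<^sup>2 \<partial>\<Omega>)" for n
  have \<Delta>: "\<Delta> \<longlonglongrightarrow> 0" using tendsto_real_sqrt[OF conv(2)] unfolding \<Delta>_def by simp
  have \<mu>'P: "\<mu>' \<in> P2"
    using conv(1) intY(2)[of "\<lambda>x. (norm x)\<^sup>2"] by (auto simp: P2_iff \<mu>'_def prob_space_distr)
  have nX: "integrable \<Omega> (\<lambda>w. norm (X n w))" for n using integrable_of_norm_sq[OF X X2] by auto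
  have nY: "integrable \<Omega> (\<lambda>w. norm (Y w))" using integrable_of_norm_sq[OF Y conv(1)] by auto
  \<comment> \<open>Needed as a limit, not just a bound: the correction added for Fatou's lemma has
    to cancel exactly afterwards.\<close>
  have limn: "(\<lambda>n. \<integral>w. norm (X n w) \<partial>\<Omega>) \<longlonglongrightarrow> (\<integral>w. norm (Y w) \<partial>\<Omega>)"
  proof (rule LIM_zero_cancel, rule Lim_null_comparison[OF always_eventually \<Delta>], rule allI)
    fix n
    have i: "integrable \<Omega> (\<lambda>w. norm (X n w - Y w))" using integrable_of_norm_sq[OF _ XY2[of n]] by simp
    have "norm ((\<integral>w. norm (X n w) \<partial>\<Omega>) - (\<integral>w. norm (Y w) \<partial>\<Omega>)) = \<bar>\<integral>w. norm (X n w) - norm (Y w) \<partial>\<Omega>\<bar>"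
      using nX nY by simp
    also have "\<dots> \<le> (\<integral>w. \<bar>norm (X n w) - norm (Y w)\<bar> \<partial>\<Omega>)" by (rule integral_abs_bound)
    also have "\<dots> \<le> (\<integral>w. norm (X n w - Y w) \<partial>\<Omega>)"
      using nX nY i by (intro integral_mono norm_triangle_ineq3) auto
    also have "\<dots> \<le> \<Delta> n" unfolding \<Delta>_def using XY2 by (intro expectation_norm_le_L2) auto
    finally show "norm ((\<integral>w. norm (X n w) \<partial>\<Omega>) - (\<integral>w. norm (Y w) \<partial>\<Omega>)) \<le> \<Delta> n" .
  qed
  have co: "convex_order \<mu>' \<nu>"
    unfolding convex_order_def
  proof (intro allI impI)
    fix f :: "'a \<Rightarrow> real" assume f: "convex_on UNIV f" and fi: "integrable \<nu> f"
    have fc: "continuous_on UNIV f" using convex_on_continuous[OF open_UNIV f] .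
    then have fm[measurable]: "f \<in> borel_measurable borel" by (rule borel_measurable_continuous_onI)
    obtain K where K: "0 \<le> K" "\<And>x. - K * (1 + norm x) \<le> f x"
      using convex_on_lower_bound[OF f] by auto
    note cf = convex_orderD[OF \<mu>c f fi]
    have fX: "integrable \<Omega> (\<lambda>w. f (X n w))" for n using cf(1) intX(2)[OF fm] by simp
    \<comment> \<open>The linear minorant of \<open>f\<close> makes this nonnegative, as Fatou's
      lemma requires.\<close>
    let ?u = "\<lambda>x. f x + K * (1 + norm x)"
    have "integrable \<Omega> (\<lambda>w. ?u (Y w))
      \<and> (\<integral>w. ?u (Y w) \<partial>\<Omega>) \<le> (\<integral>x. f x \<partial>\<nu>) + K * (1 + (\<integral>w. norm (Y w) \<partial>\<Omega>))"
    proof (rule integral_fatou[where u="\<lambda>n w. ?u (X n w)" and a="\<lambda>n. (\<integral>x. f x \<partial>\<nu>) + K * (1 + (\<integral>w. norm (X n w) \<partial>\<Omega>))"])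
      show "integrable \<Omega> (\<lambda>w. ?u (X n w))" for n using fX nX by simp
      show "AE w in \<Omega>. 0 \<le> ?u (X n w)" for n
      proof (rule AE_I2)
        fix w show "0 \<le> ?u (X n w)" using K(2)[of "X n w"] by simp
      qed
      show "AE w in \<Omega>. (\<lambda>n. ?u (X n w)) \<longlonglongrightarrow> ?u (Y w)"
        using lim
      proof eventually_elim
        case (elim w)
        have "(\<lambda>n. f (X n w)) \<longlonglongrightarrow> f (Y w)"
          using continuous_on_tendsto_compose[OF fc elim] by simp
        then show ?case using elim by (intro tendsto_intros)
      qed
      have "(\<integral>w. ?u (X n w) \<partial>\<Omega>) = (\<integral>w. f (X n w) \<partial>\<Omega>) + K * (1 + (\<integral>w. norm (X n w) \<partial>\<Omega>))" for n
        using fX nX by (simp add: prob_space)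
      then show "(\<integral>w. ?u (X n w) \<partial>\<Omega>) \<le> (\<integral>x. f x \<partial>\<nu>) + K * (1 + (\<integral>w. norm (X n w) \<partial>\<Omega>))" for n
        using cf(2)[of "r n"] intX(1)[OF fm, of n] by simp
      show "(\<lambda>n. (\<integral>x. f x \<partial>\<nu>) + K * (1 + (\<integral>w. norm (X n w) \<partial>\<Omega>)))
          \<longlonglongrightarrow> (\<integral>x. f x \<partial>\<nu>) + K * (1 + (\<integral>w. norm (Y w) \<partial>\<Omega>))"
        by (intro tendsto_intros limn)
    qed measurable
    then have fat: "integrable \<Omega> (\<lambda>w. ?u (Y w))"
      "(\<integral>w. ?u (Y w) \<partial>\<Omega>) \<le> (\<integral>x. f x \<partial>\<nu>) + K * (1 + (\<integral>w. norm (Y w) \<partial>\<Omega>))" by auto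
    have "integrable \<Omega> (\<lambda>w. ?u (Y w) - K * (1 + norm (Y w)))"
      using fat(1) nY by (intro Bochner_Integration.integrable_diff) auto
    then have fY: "integrable \<Omega> (\<lambda>w. f (Y w))" by simp
    have "(\<integral>w. ?u (Y w) \<partial>\<Omega>) = (\<integral>w. f (Y w) \<partial>\<Omega>) + K * (1 + (\<integral>w. norm (Y w) \<partial>\<Omega>))"
      using fY nY by (simp add: prob_space)
    then have "(\<integral>w. f (Y w) \<partial>\<Omega>) \<le> (\<integral>x. f x \<partial>\<nu>)" using fat(2) by simp
    then show "integrable \<mu>' f \<and> (\<integral>x. f x \<partial>\<mu>') \<le> (\<integral>x. f x \<partial>\<nu>)"
      using fY intY[OF fm] by simp
  qed
  have W: "(\<lambda>n. W2 (\<mu> (r n)) \<mu>') \<longlonglongrightarrow> 0"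
  proof (rule Lim_null_comparison[OF always_eventually \<Delta>], rule allI)
    fix n
    \<comment> \<open>The joint law of \<open>X n\<close> and \<open>Y\<close> is a competitor in
      the infimum.\<close>
    define \<pi> where "\<pi> = distr \<Omega> (borel \<Otimes>\<^sub>M borel) (\<lambda>w. (X n w, Y w))"
    have "distr \<pi> borel fst = \<mu> (r n)" "distr \<pi> borel snd = \<mu>'"
      unfolding \<pi>_def \<mu>'_def dX[symmetric] by (subst distr_distr; auto simp: comp_def)+
    then have "\<pi> \<in> couplings (\<mu> (r n)) \<mu>'"
      unfolding couplings_def by (auto simp: \<pi>_def intro!: prob_space_distr)
    from W2_le[OF this] have "W2 (\<mu> (r n)) \<mu>' \<le> \<Delta> n"
      unfolding \<pi>_def \<Delta>_def by (subst (asm) integral_distr) auto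
    then show "norm (W2 (\<mu> (r n)) \<mu>') \<le> \<Delta> n" using W2_nonneg[OF \<mu>P \<mu>'P] by simp
  qed
  define m where "m = (\<integral>x. x \<partial>\<nu>)"
  \<comment> \<open>All means equal the mean \<open>m\<close> of \<open>\<nu>\<close>, so each
    standard deviation is an L2 distance to the same constant and the reverse triangle inequality
    applies.\<close>
  have VX: "Var (\<mu> (r n)) = (\<integral>w. (norm (X n w - m))\<^sup>2 \<partial>\<Omega>)" for n
    unfolding Var_def convex_order_mean_eq[OF \<mu>P \<nu> \<mu>c] m_def[symmetric]
    by (rule intX(1)[symmetric]) measurable
  have VY: "Var \<mu>' = (\<integral>w. (norm (Y w - m))\<^sup>2 \<partial>\<Omega>)"
    unfolding Var_def convex_order_mean_eq[OF \<mu>'P \<nu> co] m_def[symmetric]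
    by (rule intY(1)[symmetric]) measurable
  have Xm: "integrable \<Omega> (\<lambda>w. (norm (X n w - m))\<^sup>2)" for n
    using X2 by (intro integrable_norm_sq_diff) auto
  have Ym: "integrable \<Omega> (\<lambda>w. (norm (Y w - m))\<^sup>2)"
    using conv(1) by (intro integrable_norm_sq_diff) auto
  have "(\<lambda>n. sqrt (Var (\<mu> (r n)))) \<longlonglongrightarrow> sqrt (Var \<mu>')"
  proof (rule LIM_zero_cancel, rule Lim_null_comparison[OF always_eventually \<Delta>], rule allI)
    fix n
    have "sqrt (\<integral>w. (norm ((X n w - Y w) + (Y w - m)))\<^sup>2 \<partial>\<Omega>) \<le> \<Delta> n + sqrt (Var \<mu>')"
      unfolding \<Delta>_def VY using XY2 Ym by (intro L2_minkowski) auto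
    moreover have "sqrt (\<integral>w. (norm ((X n w - m) - (X n w - Y w)))\<^sup>2 \<partial>\<Omega>) \<le> sqrt (Var (\<mu> (r n))) + \<Delta> n"
      unfolding \<Delta>_def VX using XY2 Xm by (intro L2_minkowski_diff) auto
    ultimately show "norm (sqrt (Var (\<mu> (r n))) - sqrt (Var \<mu>')) \<le> \<Delta> n"
      by (simp add: VX VY abs_le_iff)
  qed
  then have "(\<lambda>n. (sqrt (Var (\<mu> (r n))))\<^sup>2) \<longlonglongrightarrow> (sqrt (Var \<mu>'))\<^sup>2" by (rule tendsto_power)
  then have "(\<lambda>n. Var (\<mu> (r n))) \<longlonglongrightarrow> Var \<mu>'" by (simp add: Var_def)
  then show thesis using that[OF r _ W] \<mu>'P co by (auto simp: M_nu_def)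
qed

section \<open>Existence of a maximizer and the stability estimate\<close>

lemma V_maximizer_exists:
  fixes \<nu> :: "'a::euclidean_space measure"
  assumes \<nu>: "\<nu> \<in> P2" and D: "W2_closed D" and ne: "D \<inter> M_nu \<nu> \<noteq> {}"
  shows "\<exists>\<mu>. is_V_maximizer D \<nu> \<mu>"
proof -
  define S where "S = (SUP \<mu>\<in>D \<inter> M_nu \<nu>. Var \<mu>)"
  \<comment> \<open>Boundedness above makes the real-valued supremum \<open>S\<close>
    meaningful.\<close>
  have "Var \<mu> \<le> Var \<nu>" if "\<mu> \<in> M_nu \<nu>" for \<mu>
    using that convex_order_Var_diff[of \<mu> \<nu>] convex_order_second_moment_le[of \<nu> \<mu>] \<nu>
    by (auto simp: M_nu_def)
  then have bdd: "bdd_above (Var ` (D \<inter> M_nu \<nu>))" by (intro bdd_aboveI2) auto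
  have "\<exists>\<mu>\<in>D \<inter> M_nu \<nu>. S - 1 / Suc n < Var \<mu>" for n
    using less_cSUP_iff[OF ne bdd, of "S - 1 / Suc n"] by (simp add: S_def)
  then obtain \<mu> where \<mu>: "\<And>n. \<mu> n \<in> D \<inter> M_nu \<nu>" "\<And>n. S - 1 / Suc n < Var (\<mu> n)" by metis
  obtain r \<mu>' where r: "strict_mono (r :: nat \<Rightarrow> nat)" and \<mu>': "\<mu>' \<in> M_nu \<nu>"
    and W: "(\<lambda>n. W2 (\<mu> (r n)) \<mu>') \<longlonglongrightarrow> 0" and Vl: "(\<lambda>n. Var (\<mu> (r n))) \<longlonglongrightarrow> Var \<mu>'"
    using M_nu_sequentially_compact[OF \<nu>, of \<mu>] \<mu>(1) by auto
  have "\<mu>' \<in> D"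
    using D[unfolded W2_closed_def, rule_format, of "\<lambda>n. \<mu> (r n)" \<mu>'] \<mu>(1) \<mu>' W by (auto simp: M_nu_def)
  moreover have "S \<le> Var \<mu>'"
  proof (rule LIMSEQ_le[OF _ Vl])
    have "(\<lambda>n. S - 1 / real (Suc n)) \<longlonglongrightarrow> S - 0"
      by (intro tendsto_intros LIMSEQ_inverse_real_of_nat[unfolded inverse_eq_divide])
    then show "(\<lambda>n. S - 1 / real (Suc n)) \<longlonglongrightarrow> S" by simp
    have "S - 1 / real (Suc n) \<le> Var (\<mu> (r n))" for n
    proof -
      have "1 / real (Suc (r n)) \<le> 1 / real (Suc n)"
        using seq_suble[OF r, of n] by (intro divide_left_mono) auto
      then show ?thesis using \<mu>(2)[of "r n"] by linarith
    qed
    then show "\<exists>N. \<forall>n\<ge>N. S - 1 / real (Suc n) \<le> Var (\<mu> (r n))" by blast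
  qed
  moreover have "Var \<rho> \<le> S" if "\<rho> \<in> D \<inter> M_nu \<nu>" for \<rho>
    unfolding S_def using that bdd by (rule cSUP_upper)
  ultimately show ?thesis unfolding is_V_maximizer_def using \<mu>' by (intro exI[of _ \<mu>']) force
qed

theorem mainTheorem3:
  fixes \<nu> :: "'a::euclidean_space measure" and D :: "'a measure set"
  assumes "\<nu> \<in> P2" and "D \<subseteq> P2"
  shows "(W2_closed D \<and> D \<inter> M_nu \<nu> \<noteq> {} \<longrightarrow> (\<exists>\<mu>. is_V_maximizer D \<nu> \<mu>))
    \<and> (\<forall>\<mu>s. is_V_maximizer D \<nu> \<mu>s \<longrightarrow>
         (\<forall>\<rho>\<in>D. convex_order \<rho> \<nu> \<longrightarrow> W2 \<mu>s \<rho> \<le> sqrt (Var \<nu> - Var \<rho>) + W2 \<nu> \<rho>))"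
proof (intro conjI impI allI ballI)
  show "\<exists>\<mu>. is_V_maximizer D \<nu> \<mu>" if "W2_closed D \<and> D \<inter> M_nu \<nu> \<noteq> {}"
    using V_maximizer_exists[OF assms(1)] that by blast
next
  fix \<mu>s \<rho> assume max: "is_V_maximizer D \<nu> \<mu>s" and \<rho>: "\<rho> \<in> D" "convex_order \<rho> \<nu>"
  have \<rho>P: "\<rho> \<in> P2" using \<rho>(1) assms(2) by blast
  \<comment> \<open>Maximality enters only through Var \<rho> \<le> Var \<mu>s, which allows the
    bound on the distance from \<open>\<mu>s\<close> to \<open>\<nu>\<close> to be stated with
    \<open>\<rho>\<close>.\<close>
  have \<mu>s: "\<mu>s \<in> P2" "convex_order \<mu>s \<nu>" "Var \<rho> \<le> Var \<mu>s"
    using max \<rho> \<rho>P by (auto simp: is_V_maximizer_def M_nu_def)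
  have "W2 \<mu>s \<rho> \<le> W2 \<mu>s \<nu> + W2 \<nu> \<rho>" by (rule W2_triangle[OF \<mu>s(1) assms(1) \<rho>P])
  also have "W2 \<mu>s \<nu> \<le> sqrt (Var \<nu> - Var \<mu>s)" by (rule W2_le_of_convex_order[OF \<mu>s(1) assms(1) \<mu>s(2)])
  also have "\<dots> \<le> sqrt (Var \<nu> - Var \<rho>)" using \<mu>s(3) by simp
  finally show "W2 \<mu>s \<rho> \<le> sqrt (Var \<nu> - Var \<rho>) + W2 \<nu> \<rho>" by simp
qed

end
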